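(* Let $n$ be a prime number, let $p_1,p_2,p_3,p_4\in\mathbb{Z}^{+}$, let $P_1^4=(p_1,p_2,p_3,p_4)$ be an oriented $4$-pretzel link, and let $\mathbb{Z}_n$ be the dihedral quandle. Put $h=p_1p_2p_3+p_1p_2p_4+p_1p_3p_4+p_2p_3p_4$. Then, with all congruences modulo $n$, $$|\mathrm{Hom}(\mathcal{Q}(P_1^4),\mathbb{Z}_n)|=\begin{cases} n & \text{if } h\not\equiv 0;\\ n^2 & \text{if } h\equiv 0 \text{ and } p_ip_j\not\equiv 0 \text{ for at least one pair } i\neq j,\ i,j\in\{1,2,3,4\};\\ n^3 & \text{if exactly one of } p_1,p_2,p_3,p_4 \text{ is coprime with } n;\\ n^4 & \text{if } p_1\equiv p_2\equiv p_3\equiv p_4\equiv 0.\end{cases}$$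
   Context: A quandle is a set $X$ with a binary operation $\triangleright$ such that $x\triangleright x=x$ for all $x$; for each $y$ the map $x\mapsto x\triangleright y$ is invertible; and $(x\triangleright y)\triangleright z=(x\triangleright z)\triangleright(y\triangleright z)$ for all $x,y,z$. A quandle homomorphism $f$ satisfies $f(x\triangleright y)=f(x)\triangleright f(y)$. The dihedral quandle $\mathbb{Z}_n$ is the set of integers modulo $n$ with $x\triangleright y=2y-x \pmod n$. For an oriented link $K$ with diagram $D$, the fundamental quandle $\mathcal{Q}(K)$ is the quandle generated by the arcs of $D$ with one relation per crossing: if the overcrossing arc is $y$ (pointing up), and $x$ is the undercrossing arc on the right of $y$, then the undercrossing arc on the left of $y$ is $x\triangleright y$. $\mathrm{Hom}(\mathcal{Q}(K),X)$ is the set of quandle homomorphisms (colorings of $K$ by $X$); its cardinality is the coloring number of $K$ (with respect to $X$). Pretzel link: for nonzero integers $p_1,\dots,p_m$, the pretzel link $(p_1,\dots,p_m)$ (an $m$-pretzel link) is formed from $m$ tangles $A_1,\dots,A_m$ placed side by side, where $A_i$ is a vertical column of two strands twisted about each other with $|p_i|$ crossings, all of one fixed handedness if $p_i>0$ ("positive") and all of the opposite handedness if $p_i<0$ ("negative"). The NE endpoint of $A_i$ is joined to the NW endpoint of $A_{i+1}$, the SE endpoint of $A_i$ to the SW endpoint of $A_{i+1}$, and the outer endpoints are closed up by joining the NW (resp. SW) endpoint of $A_1$ to the NE (resp. SE) endpoint of $A_m$. Any orientation of the link may be chosen. *)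

theory Defs
  imports Main "HOL-Library.FuncSet" "HOL-Number_Theory.Cong" "HOL-Computational_Algebra.Primes"
begin

record 'a quandle_struct =
  qcarrier :: "'a set"
  qop :: "'a \<Rightarrow> 'a \<Rightarrow> 'a"  (infixl "\<triangleright>\<index>" 70)

locale quandle =
  fixes Q :: "'a quandle_struct" (structure)
  assumes closed: "\<lbrakk>x \<in> qcarrier Q; y \<in> qcarrier Q\<rbrakk> \<Longrightarrow> x \<triangleright> y \<in> qcarrier Q"
    and idem: "x \<in> qcarrier Q \<Longrightarrow> x \<triangleright> x = x"
    and bij: "y \<in> qcarrier Q \<Longrightarrow> bij_betw (\<lambda>x. x \<triangleright> y) (qcarrier Q) (qcarrier Q)"
    and distrib: "\<lbrakk>x \<in> qcarrier Q; y \<in> qcarrier Q; z \<in> qcarrier Q\<rbrakk>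
      \<Longrightarrow> (x \<triangleright> y) \<triangleright> z = (x \<triangleright> z) \<triangleright> (y \<triangleright> z)"

(* Homomorphisms are extensional, so that they can be counted as functions on the carrier. *)
definition Hom :: "'a quandle_struct \<Rightarrow> 'b quandle_struct \<Rightarrow> ('a \<Rightarrow> 'b) set" where
  "Hom Q X = {f \<in> qcarrier Q \<rightarrow>\<^sub>E qcarrier X.
     \<forall>x\<in>qcarrier Q. \<forall>y\<in>qcarrier Q. f (x \<triangleright>\<^bsub>Q\<^esub> y) = f x \<triangleright>\<^bsub>X\<^esub> f y}"

definition dihedral_quandle :: "nat \<Rightarrow> int quandle_struct" where
  "dihedral_quandle n =
     \<lparr>qcarrier = {0..<int n}, qop = (\<lambda>x y. (2 * y - x) mod int n)\<rparr>"

lemma dihedral_quandle_simps: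
  "qcarrier (dihedral_quandle n) = {0..<int n}"
  "qop (dihedral_quandle n) x y = (2 * y - x) mod int n"
  by (simp_all add: dihedral_quandle_def)

lemma dihedral_quandle_is_quandle: "quandle (dihedral_quandle n)"
proof
  fix x y z :: int
  have "(2 * z - (2 * y - x) mod int n) mod int n = (2 * z - (2 * y - x)) mod int n"
    by (rule mod_diff_right_eq)
  also have "2 * z - (2 * y - x) = 2 * (2 * z - y) - (2 * z - x)"
    by simp
  also have "\<dots> mod int n = (2 * ((2 * z - y) mod int n) - (2 * z - x) mod int n) mod int n"
    by (intro mod_diff_cong) (rule mod_mult_right_eq[symmetric], rule mod_mod_trivial[symmetric])
  finally show "qop (dihedral_quandle n) (qop (dihedral_quandle n) x y) z =
      qop (dihedral_quandle n) (qop (dihedral_quandle n) x z) (qop (dihedral_quandle n) y z)"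
    unfolding dihedral_quandle_simps .
next
  fix y assume "y \<in> qcarrier (dihedral_quandle n)"
  have "(2 * y - (2 * y - x) mod int n) mod int n = x" if "x \<in> {0..<int n}" for x
    unfolding mod_diff_right_eq using that by simp
  moreover have "(2 * y - x) mod int n \<in> {0..<int n}" if "x \<in> {0..<int n}" for x
    using that by simp
  ultimately show "bij_betw (\<lambda>x. qop (dihedral_quandle n) x y)
      (qcarrier (dihedral_quandle n)) (qcarrier (dihedral_quandle n))"
    unfolding dihedral_quandle_simps
    by (intro bij_betw_byWitness[where f' = "\<lambda>x. (2 * y - x) mod int n"]) blast+
qed (simp_all add: dihedral_quandle_simps)

(* Presented quandles: terms in the operation and its right inverse over a set S of generators,
   modulo the least congruence containing the relations R and the quandle axioms. *)
datatype 'g qterm = Gen 'g | Op "'g qterm" "'g qterm" | OpInv "'g qterm" "'g qterm"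

definition qterms :: "'g set \<Rightarrow> 'g qterm set" where
  "qterms S = {t. set_qterm t \<subseteq> S}"

inductive_set qcong :: "'g set \<Rightarrow> ('g qterm \<times> 'g qterm) set \<Rightarrow> ('g qterm \<times> 'g qterm) set"
  for S R where
  rel: "\<lbrakk>(s, t) \<in> R; s \<in> qterms S; t \<in> qterms S\<rbrakk> \<Longrightarrow> (s, t) \<in> qcong S R"
| refl: "s \<in> qterms S \<Longrightarrow> (s, s) \<in> qcong S R"
| sym: "(s, t) \<in> qcong S R \<Longrightarrow> (t, s) \<in> qcong S R"
| trans: "\<lbrakk>(s, t) \<in> qcong S R; (t, u) \<in> qcong S R\<rbrakk> \<Longrightarrow> (s, u) \<in> qcong S R"
| op_cong: "\<lbrakk>(s, s') \<in> qcong S R; (t, t') \<in> qcong S R\<rbrakk> \<Longrightarrow> (Op s t, Op s' t') \<in> qcong S R"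
| inv_cong: "\<lbrakk>(s, s') \<in> qcong S R; (t, t') \<in> qcong S R\<rbrakk> \<Longrightarrow> (OpInv s t, OpInv s' t') \<in> qcong S R"
| idem: "s \<in> qterms S \<Longrightarrow> (Op s s, s) \<in> qcong S R"
| op_inv: "\<lbrakk>s \<in> qterms S; t \<in> qterms S\<rbrakk> \<Longrightarrow> (Op (OpInv s t) t, s) \<in> qcong S R"
| inv_op: "\<lbrakk>s \<in> qterms S; t \<in> qterms S\<rbrakk> \<Longrightarrow> (OpInv (Op s t) t, s) \<in> qcong S R"
| distrib: "\<lbrakk>s \<in> qterms S; t \<in> qterms S; u \<in> qterms S\<rbrakk>
    \<Longrightarrow> (Op (Op s t) u, Op (Op s u) (Op t u)) \<in> qcong S R"

definition presented_quandle ::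
  "'g set \<Rightarrow> ('g qterm \<times> 'g qterm) set \<Rightarrow> 'g qterm set quandle_struct" where
  "presented_quandle S R =
     \<lparr>qcarrier = qterms S // qcong S R,
      qop = (\<lambda>A B. \<Union>a\<in>A. \<Union>b\<in>B. qcong S R `` {Op a b})\<rparr>"

lemma qterms_simps [simp]:
  "Gen g \<in> qterms S \<longleftrightarrow> g \<in> S"
  "Op s t \<in> qterms S \<longleftrightarrow> s \<in> qterms S \<and> t \<in> qterms S"
  "OpInv s t \<in> qterms S \<longleftrightarrow> s \<in> qterms S \<and> t \<in> qterms S"
  by (auto simp: qterms_def)

lemma qcong_in_qterms: "(s, t) \<in> qcong S R \<Longrightarrow> s \<in> qterms S \<and> t \<in> qterms S"
  by (induction rule: qcong.induct) auto

lemma equiv_qcong: "equiv (qterms S) (qcong S R)"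
  by (intro equivI refl_onI symI transI)
     (auto dest: qcong_in_qterms intro: qcong.refl qcong.sym qcong.trans)

lemma presented_quandle_op:
  assumes "s \<in> qterms S" "t \<in> qterms S"
  shows "qop (presented_quandle S R) (qcong S R `` {s}) (qcong S R `` {t})
    = qcong S R `` {Op s t}"
proof -
  have "(\<lambda>a b. qcong S R `` {Op a b}) respects2 qcong S R"
    by (intro congruent2I' equiv_class_eq[OF equiv_qcong] qcong.op_cong)
  from UN_equiv_class2[OF equiv_qcong equiv_qcong this assms]
  show ?thesis by (simp add: presented_quandle_def)
qed

lemma presented_quandle_is_quandle: "quandle (presented_quandle S R)"
proof -
  let ?Q = "presented_quandle S R" and ?c = "\<lambda>s. qcong S R `` {s}"
  have car: "qcarrier ?Q = ?c ` qterms S"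
    by (auto simp: presented_quandle_def quotient_def)
  have eq: "?c s = ?c t" if "(s, t) \<in> qcong S R" for s t
    using that by (rule equiv_class_eq[OF equiv_qcong])
  note [simp] = presented_quandle_op
  show ?thesis
  proof
    fix B assume "B \<in> qcarrier ?Q"
    then obtain b where b: "b \<in> qterms S" "B = ?c b" by (auto simp: car)
    have *: "?c s = ?c t" if "?c (Op s b) = ?c (Op t b)" "s \<in> qterms S" "t \<in> qterms S" for s t
    proof -
      have "(Op s b, Op t b) \<in> qcong S R"
        using that b equiv_class_eq_iff[OF equiv_qcong] by (metis qterms_simps(2))
      then have "(OpInv (Op s b) b, OpInv (Op t b) b) \<in> qcong S R"
        using b by (intro qcong.inv_cong qcong.refl)
      then show ?thesis
        using that b by (intro eq) (meson qcong.inv_op qcong.sym qcong.trans)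
    qed
    have inj: "inj_on (\<lambda>A. qop ?Q A B) (?c ` qterms S)"
    proof (rule inj_onI, elim imageE)
      fix A A' s t
      assume "qop ?Q A B = qop ?Q A' B" and st: "A = ?c s" "s \<in> qterms S" "A' = ?c t" "t \<in> qterms S"
      then have "?c (Op s b) = ?c (Op t b)"
        using b by simp
      then show "A = A'"
        unfolding st(1,3) using st(2,4) by (rule *)
    qed
    have "(\<lambda>A. qop ?Q A B) ` ?c ` qterms S = ?c ` qterms S"
    proof (intro equalityI subsetI)
      fix C assume "C \<in> (\<lambda>A. qop ?Q A B) ` ?c ` qterms S"
      then obtain s where s: "s \<in> qterms S" "C = qop ?Q (?c s) B"
        by blast
      then have "C = ?c (Op s b)" using b by simp
      then show "C \<in> ?c ` qterms S" using s b by simp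
    next
      fix C assume "C \<in> ?c ` qterms S"
      then obtain s where s: "s \<in> qterms S" "C = ?c s"
        by blast
      have "qop ?Q (?c (OpInv s b)) B = ?c (Op (OpInv s b) b)"
        using s b by simp
      also have "\<dots> = C"
        unfolding s(2) using s b by (intro eq qcong.op_inv)
      finally show "C \<in> (\<lambda>A. qop ?Q A B) ` ?c ` qterms S"
        using s b by (intro image_eqI[of _ _ "?c (OpInv s b)"] image_eqI[of _ _ "OpInv s b"]) auto
    qed
    with inj show "bij_betw (\<lambda>A. qop ?Q A B) (qcarrier ?Q) (qcarrier ?Q)"
      unfolding car bij_betw_def by blast
  next
    fix A B assume "A \<in> qcarrier ?Q" "B \<in> qcarrier ?Q"
    then obtain s t where "s \<in> qterms S" "A = ?c s" "t \<in> qterms S" "B = ?c t"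
      unfolding car by blast
    then show "qop ?Q A B \<in> qcarrier ?Q" unfolding car by simp
  next
    fix A assume "A \<in> qcarrier ?Q"
    then obtain s where "s \<in> qterms S" "A = ?c s" unfolding car by blast
    then show "qop ?Q A A = A" using eq[OF qcong.idem] by simp
  next
    fix A B C assume "A \<in> qcarrier ?Q" "B \<in> qcarrier ?Q" "C \<in> qcarrier ?Q"
    then obtain s t u where "s \<in> qterms S" "A = ?c s" "t \<in> qterms S" "B = ?c t"
      "u \<in> qterms S" "C = ?c u"
      unfolding car by blast
    then show "qop ?Q (qop ?Q A B) C = qop ?Q (qop ?Q A C) (qop ?Q B C)"
      by (simp add: eq[OF qcong.distrib[of s S t u R]])
  qed
qed

(* A link diagram is encoded by its crossings. Four edges of the underlying 4-valent plane graph
   meet at the corners of a crossing; an edge running between two corners is the same label at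
   both. overpass c k says that the strand through corner k of c is the upper one there.
   Components without any crossing cannot be represented. *)
datatype corner = NE | NW | SW | SE

fun ccw :: "corner \<Rightarrow> corner" where
  "ccw NE = NW" | "ccw NW = SW" | "ccw SW = SE" | "ccw SE = NE"

fun cw :: "corner \<Rightarrow> corner" where
  "cw NE = SE" | "cw SE = SW" | "cw SW = NW" | "cw NW = NE"

fun opposite :: "corner \<Rightarrow> corner" where
  "opposite NE = SW" | "opposite SW = NE" | "opposite NW = SE" | "opposite SE = NW"

record ('c, 'e) diagram =
  crossings :: "'c set"
  edge :: "'c \<Rightarrow> corner \<Rightarrow> 'e"
  overpass :: "'c \<Rightarrow> corner \<Rightarrow> bool"

definition edges :: "('c, 'e) diagram \<Rightarrow> 'e set" where
  "edges D = {edge D c k | c k. c \<in> crossings D}"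

definition link_diagram :: "('c, 'e) diagram \<Rightarrow> bool" where
  "link_diagram D \<longleftrightarrow>
     finite (crossings D) \<and>
     (\<forall>e\<in>edges D. card {(c, k). c \<in> crossings D \<and> edge D c k = e} = 2) \<and>
     (\<forall>c\<in>crossings D. \<forall>k. overpass D c (opposite k) = overpass D c k
        \<and> overpass D c (ccw k) \<noteq> overpass D c k)"

(* An orientation says for each corner whether the strand leaves the crossing there: strands run
   straight through a crossing, and an edge that leaves one of its ends arrives at the other. *)
definition orientation :: "('c, 'e) diagram \<Rightarrow> ('c \<Rightarrow> corner \<Rightarrow> bool) \<Rightarrow> bool" where
  "orientation D out \<longleftrightarrow>
     (\<forall>c\<in>crossings D. \<forall>k. out c (opposite k) \<noteq> out c k) \<and>
     (\<forall>c\<in>crossings D. \<forall>c'\<in>crossings D. \<forall>k k'.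
        (c, k) \<noteq> (c', k') \<and> edge D c k = edge D c' k' \<longrightarrow> out c k \<noteq> out c' k')"

(* An arc is a maximal union of edges that continue each other through overcrossings. *)
definition over_rel :: "('c, 'e) diagram \<Rightarrow> ('e \<times> 'e) set" where
  "over_rel D = {(edge D c k, edge D c (opposite k)) | c k. c \<in> crossings D \<and> overpass D c k}"

definition arc_of :: "('c, 'e) diagram \<Rightarrow> 'e \<Rightarrow> 'e set" where
  "arc_of D e = (over_rel D)\<^sup>* `` {e}"

definition arcs :: "('c, 'e) diagram \<Rightarrow> 'e set set" where
  "arcs D = arc_of D ` edges D"

(* k is the corner at which the overcrossing strand leaves c; looking in that direction, the
   undercrossing arc on the right is at cw k and the one on the left is at ccw k. *)
definition crossing_relations ::
  "('c, 'e) diagram \<Rightarrow> ('c \<Rightarrow> corner \<Rightarrow> bool) \<Rightarrow> ('e set qterm \<times> 'e set qterm) set" where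
  "crossing_relations D out =
     {(Gen (arc_of D (edge D c (ccw k))),
       Op (Gen (arc_of D (edge D c (cw k)))) (Gen (arc_of D (edge D c k)))) | c k.
       c \<in> crossings D \<and> overpass D c k \<and> out c k}"

definition fundamental_quandle ::
  "('c, 'e) diagram \<Rightarrow> ('c \<Rightarrow> corner \<Rightarrow> bool) \<Rightarrow> 'e set qterm set quandle_struct" where
  "fundamental_quandle D out = presented_quandle (arcs D) (crossing_relations D out)"

(* Standard diagram of the pretzel link of a list of nonzero integers. Columns are indexed from 0,
   crossing (i, k) is the k-th one from the top in column i. Top i and Bottom i join column i
   to its cyclic predecessor; InnerL i k and InnerR i k are the edges between crossings
   k - 1 and k of column i. In a positive column the strand from SW to NE is the upper one. *)
datatype pretzel_edge = Top nat | Bottom nat | InnerL nat nat | InnerR nat nat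

definition left_edge :: "int list \<Rightarrow> nat \<Rightarrow> nat \<Rightarrow> pretzel_edge" where
  "left_edge ps i k =
     (if k = 0 then Top i else if k = nat \<bar>ps ! i\<bar> then Bottom i else InnerL i k)"

definition right_edge :: "int list \<Rightarrow> nat \<Rightarrow> nat \<Rightarrow> pretzel_edge" where
  "right_edge ps i k =
     (if k = 0 then Top (Suc i mod length ps)
      else if k = nat \<bar>ps ! i\<bar> then Bottom (Suc i mod length ps) else InnerR i k)"

definition pretzel :: "int list \<Rightarrow> (nat \<times> nat, pretzel_edge) diagram" where
  "pretzel ps =
     \<lparr>crossings = {(i, k). i < length ps \<and> k < nat \<bar>ps ! i\<bar>},
      edge = (\<lambda>(i, k) q. case q of
          NW \<Rightarrow> left_edge ps i k
        | NE \<Rightarrow> right_edge ps i k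
        | SW \<Rightarrow> left_edge ps i (Suc k)
        | SE \<Rightarrow> right_edge ps i (Suc k)),
      overpass = (\<lambda>(i, k) q. if ps ! i > 0 then q \<in> {SW, NE} else q \<in> {NW, SE})\<rparr>"

lemma link_diagram_pretzel:
  assumes "ps \<noteq> []" "\<forall>p\<in>set ps. p \<noteq> 0"
  shows "link_diagram (pretzel ps)"
proof -
  let ?m = "length ps" and ?D = "pretzel ps"
  define N where "N i = nat \<bar>ps ! i\<bar>" for i
  define pre where "pre i = (if i = 0 then ?m - 1 else i - 1)" for i
  have m: "?m > 0" using assms by simp
  have N: "N i > 0" if "i < ?m" for i
    using assms that by (auto simp: N_def)
  have pre: "pre i < ?m" if "i < ?m" for i
    using that by (auto simp: pre_def)
  have suc: "Suc j mod ?m = i \<longleftrightarrow> j = pre i" if "i < ?m" "j < ?m" for i j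
    using that by (cases "Suc j = ?m") (auto simp: pre_def)
  have suc_lt: "Suc j mod ?m < ?m" for j
    using m by simp
  let ?E = "\<lambda>e. {(c, k). c \<in> crossings ?D \<and> edge ?D c k = e}"
  have E: "(x, q) \<in> ?E e \<longleftrightarrow> fst x < ?m \<and> snd x < N (fst x) \<and> edge ?D x q = e" for x q e
    by (auto simp: pretzel_def N_def)
  have top: "?E (Top i) = {((i, 0), NW), ((pre i, 0), NE)}" if "i < ?m" for i
  proof (intro set_eqI)
    fix z :: "(nat \<times> nat) \<times> corner"
    obtain j k q where z: "z = ((j, k), q)" by (metis prod.exhaust)
    show "z \<in> ?E (Top i) \<longleftrightarrow> z \<in> {((i, 0), NW), ((pre i, 0), NE)}"
      unfolding z E using that N pre suc[OF that]
      by (cases q) (auto simp: pretzel_def left_edge_def right_edge_def)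
  qed
  have bot: "?E (Bottom i) = {((i, N i - 1), SW), ((pre i, N (pre i) - 1), SE)}" if "i < ?m" for i
  proof (intro set_eqI)
    fix z :: "(nat \<times> nat) \<times> corner"
    obtain j k q where z: "z = ((j, k), q)" by (metis prod.exhaust)
    show "z \<in> ?E (Bottom i) \<longleftrightarrow> z \<in> {((i, N i - 1), SW), ((pre i, N (pre i) - 1), SE)}"
      unfolding z E using that N[OF that] N[OF pre[OF that]] pre[OF that] suc[OF that, of j]
      by (cases q; cases "j = pre i") (auto simp: pretzel_def left_edge_def right_edge_def N_def[symmetric])
  qed
  have inner_ends: "?E (InnerL i k) = {((i, k), NW), ((i, k - 1), SW)}"
      "?E (InnerR i k) = {((i, k), NE), ((i, k - 1), SE)}" if "i < ?m" "0 < k" "k < N i" for i k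
  proof -
    have "z \<in> ?E (InnerL i k) \<longleftrightarrow> z \<in> {((i, k), NW), ((i, k - 1), SW)}"
      "z \<in> ?E (InnerR i k) \<longleftrightarrow> z \<in> {((i, k), NE), ((i, k - 1), SE)}" for z
    proof -
      obtain j l q where z: "z = ((j, l), q)" by (metis prod.exhaust)
      show "z \<in> ?E (InnerL i k) \<longleftrightarrow> z \<in> {((i, k), NW), ((i, k - 1), SW)}"
        unfolding z E using that
        by (cases q) (auto simp: pretzel_def left_edge_def right_edge_def N_def[symmetric])
      show "z \<in> ?E (InnerR i k) \<longleftrightarrow> z \<in> {((i, k), NE), ((i, k - 1), SE)}"
        unfolding z E using that
        by (cases q) (auto simp: pretzel_def left_edge_def right_edge_def N_def[symmetric])
    qed
    then show "?E (InnerL i k) = {((i, k), NW), ((i, k - 1), SW)}"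
      "?E (InnerR i k) = {((i, k), NE), ((i, k - 1), SE)}" by blast+
  qed
  have card_left: "card (?E (left_edge ps i l)) = 2" and card_right: "card (?E (right_edge ps i l)) = 2"
    if "i < ?m" "l \<le> N i" for i l
  proof -
    have two: "card {(x, q), (y, q')} = 2" if "q \<noteq> q'"
      for x y :: "nat \<times> nat" and q q' :: corner
      using that by simp
    consider (0) "l = 0" | (N) "l \<noteq> 0" "l = N i" | (inner) "l \<noteq> 0" "l \<noteq> N i"
      by blast
    then have "card (?E (left_edge ps i l)) = 2 \<and> card (?E (right_edge ps i l)) = 2"
    proof cases
      case 0
      then have "left_edge ps i l = Top i" "right_edge ps i l = Top (Suc i mod ?m)"
        by (simp_all add: left_edge_def right_edge_def)
      then show ?thesis
        unfolding \<open>left_edge ps i l = _\<close> \<open>right_edge ps i l = _\<close> top[OF that(1)] top[OF suc_lt]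
        by (intro conjI two) simp_all
    next
      case N
      then have "left_edge ps i l = Bottom i" "right_edge ps i l = Bottom (Suc i mod ?m)"
        by (simp_all add: left_edge_def right_edge_def N_def)
      then show ?thesis
        unfolding \<open>left_edge ps i l = _\<close> \<open>right_edge ps i l = _\<close> bot[OF that(1)] bot[OF suc_lt]
        by (intro conjI two) simp_all
    next
      case inner
      then have l: "0 < l" "l < N i" using that by auto
      from inner have "left_edge ps i l = InnerL i l" "right_edge ps i l = InnerR i l"
        by (simp_all add: left_edge_def right_edge_def N_def)
      then show ?thesis
        unfolding \<open>left_edge ps i l = _\<close> \<open>right_edge ps i l = _\<close> inner_ends[OF that(1) l]
        by (intro conjI two) simp_all
    qed
    then show "card (?E (left_edge ps i l)) = 2" "card (?E (right_edge ps i l)) = 2" by blast+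
  qed
  have "card (?E e) = 2" if e_in: "e \<in> edges ?D" for e
  proof -
    obtain c q where c: "c \<in> crossings ?D" "e = edge ?D c q"
      using e_in unfolding edges_def by blast
    obtain i k where "c = (i, k)" by fastforce
    with c have e: "i < ?m" "k < N i" "e = edge ?D (i, k) q"
      by (simp_all add: pretzel_def N_def)
    then have "e = left_edge ps i k \<or> e = left_edge ps i (Suc k) \<or>
        e = right_edge ps i k \<or> e = right_edge ps i (Suc k)"
      by (cases q) (simp_all add: pretzel_def)
    moreover have "k \<le> N i" "Suc k \<le> N i" using e(2) by simp_all
    ultimately show ?thesis
      using card_left[OF e(1)] card_right[OF e(1)] by (elim disjE) (simp_all only:)
  qed
  moreover have "finite (crossings ?D)"
  proof -
    have "crossings ?D = Sigma {..<?m} (\<lambda>i. {..<N i})"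
      by (auto simp: pretzel_def N_def)
    then show ?thesis by simp
  qed
  moreover have "overpass ?D c (opposite q) = overpass ?D c q \<and>
      overpass ?D c (ccw q) \<noteq> overpass ?D c q" for c q
    by (cases c; cases q) (auto simp: pretzel_def)
  ultimately show ?thesis by (simp add: link_diagram_def)
qed

end

theory Submission
  imports Defs
begin

text \<open>
  For a prime \<open>n\<close>, the number of colorings of a pretzel link by the dihedral quandle is a count of
  solutions of linear congruences modulo \<open>n\<close>, and the shape of the diagram makes the system small.

  A homomorphism out of a presented quandle is an assignment to the generators that respects the
  relations (\<open>bij_betw_Hom_presented\<close>), so homomorphisms out of the fundamental quandle are
  colorings of the arcs. It is convenient to color the edges of the diagram instead, and to ask
  that the color does not change along an overpass (\<open>bij_betw_solutions_colorings\<close>). In a dihedral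
  quandle \<open>z = x \<triangleright> y\<close> says \<open>z + x = 2 * y\<close>, which is symmetric in \<open>x\<close> and \<open>z\<close>: the choice of
  orientation disappears (\<open>colorings_dihedral_quandle\<close>).

  In one column, let \<open>x\<close> and \<open>x + d\<close> be the colors at the two top corners. Each crossing replaces
  the pair of colors \<open>(l, r)\<close> by \<open>(l \<plusminus> d, r \<plusminus> d)\<close>, with the sign of the column, so that the difference
  \<open>d\<close> is preserved and a column with \<open>p\<close> signed crossings shifts both colors by \<open>p * d\<close>. Hence a
  coloring is determined by the colors \<open>x\<^sub>i\<close> of the top edges. With \<open>d\<^sub>i = x\<^sub>i\<^sub>+\<^sub>1 - x\<^sub>i\<close>, taken cyclically,
  the bottom edge between two neighbouring columns receives the same color from both of them if and
  only if \<open>p\<^sub>i * d\<^sub>i\<close> is the same for both; this is the only condition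
  (\<open>bij_betw_fox_colorings_pretzel\<close>).

  It remains to choose one color, in \<open>n\<close> ways, and differences \<open>d\<^sub>i\<close> with sum \<open>0\<close> such that all
  \<open>p\<^sub>i * d\<^sub>i\<close> agree. If some \<open>p\<^sub>i\<close> vanishes modulo \<open>n\<close>, the common value is \<open>0\<close>, the differences of the
  columns with invertible \<open>p\<^sub>i\<close> vanish, and the others are arbitrary with sum \<open>0\<close>: with \<open>k\<close>
  vanishing entries there are \<open>n ^ (k - 1)\<close> choices. If all \<open>p\<^sub>i\<close> are invertible, \<open>d\<^sub>i\<close> is a multiple
  \<open>c\<close> of the product of all \<open>p\<^sub>j\<close> with \<open>j \<noteq> i\<close>, and the sum of the differences is \<open>c * h\<close> for the sum
  \<open>h\<close> of these products: \<open>c\<close> is free if \<open>h\<close> vanishes, and \<open>0\<close> otherwise. This gives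
  \<open>card_Hom_pretzel\<close> for any number of columns of either sign; four positive columns are the case
  of the theorem.
\<close>

section \<open>Homomorphisms out of a presented quandle\<close>

primrec qeval :: "'x quandle_struct \<Rightarrow> ('g \<Rightarrow> 'x) \<Rightarrow> 'g qterm \<Rightarrow> 'x" where
  "qeval X g (Gen a) = g a"
| "qeval X g (Op s t) = qop X (qeval X g s) (qeval X g t)"
| "qeval X g (OpInv s t) =
     inv_into (qcarrier X) (\<lambda>x. qop X x (qeval X g t)) (qeval X g s)"

lemma quandle_right_division:
  assumes "quandle X" "x \<in> qcarrier X" "y \<in> qcarrier X"
  shows "inv_into (qcarrier X) (\<lambda>x. qop X x y) x \<in> qcarrier X"
    and "qop X (inv_into (qcarrier X) (\<lambda>x. qop X x y) x) y = x"
    and "inv_into (qcarrier X) (\<lambda>x. qop X x y) (qop X x y) = x"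
proof -
  have b: "bij_betw (\<lambda>x. qop X x y) (qcarrier X) (qcarrier X)"
    using quandle.bij[OF assms(1,3)] .
  show "inv_into (qcarrier X) (\<lambda>x. qop X x y) x \<in> qcarrier X"
    using b assms(2) by (metis bij_betw_imp_surj_on inv_into_into)
  show "qop X (inv_into (qcarrier X) (\<lambda>x. qop X x y) x) y = x"
    using bij_betw_inv_into_right[OF b assms(2)] .
  show "inv_into (qcarrier X) (\<lambda>x. qop X x y) (qop X x y) = x"
    using bij_betw_inv_into_left[OF b assms(2)] .
qed

lemma qeval_closed:
  assumes "quandle X" "g \<in> S \<rightarrow> qcarrier X" "t \<in> qterms S"
  shows "qeval X g t \<in> qcarrier X"
  using assms(3)
  by (induction t)
     (use assms(1,2) in \<open>auto simp: quandle.closed quandle_right_division(1)\<close>)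

definition presentation_solutions ::
  "'g set \<Rightarrow> ('g qterm \<times> 'g qterm) set \<Rightarrow> 'x quandle_struct \<Rightarrow> ('g \<Rightarrow> 'x) set" where
  "presentation_solutions S R X = {g \<in> S \<rightarrow>\<^sub>E qcarrier X.
     \<forall>(s, t) \<in> R. s \<in> qterms S \<longrightarrow> t \<in> qterms S \<longrightarrow> qeval X g s = qeval X g t}"

text \<open>
  Each clause generating the congruence is a law of every quandle or one of the relations, so
  evaluation descends to the presented quandle.
\<close>

lemma qeval_qcong:
  assumes X: "quandle X" and g: "g \<in> presentation_solutions S R X" and "(s, t) \<in> qcong S R"
  shows "qeval X g s = qeval X g t"
proof -
  have cl: "qeval X g t \<in> qcarrier X" if "t \<in> qterms S" for t
    using g that by (intro qeval_closed[OF X]) (auto simp: presentation_solutions_def)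
  from assms(3) show ?thesis
  proof (induction rule: qcong.induct)
    case (rel s t)
    then show ?case using g by (auto simp: presentation_solutions_def)
  qed (auto simp: cl quandle.idem[OF X] quandle_right_division[OF X] quandle.distrib[OF X])
qed

lemma qcarrier_presented:
  "qcarrier (presented_quandle S R) = (\<lambda>t. qcong S R `` {t}) ` qterms S"
  by (auto simp: presented_quandle_def quotient_def)

text \<open>
  A homomorphism is only required to respect \<open>\<triangleright>\<close>. It respects the right inverse as well, because
  right translations of the target are injective; therefore its values on generators determine it.
\<close>

lemma Hom_presented_qeval:
  assumes X: "quandle X" and F: "F \<in> Hom (presented_quandle S R) X" and t: "t \<in> qterms S"
  shows "F (qcong S R `` {t}) = qeval X (\<lambda>a\<in>S. F (qcong S R `` {Gen a})) t"
  using t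
proof (induction t)
  case (Op s t)
  then show ?case
    using F by (auto simp: Hom_def qcarrier_presented simp flip: presented_quandle_op)
next
  case (OpInv s t)
  let ?c = "\<lambda>t. qcong S R `` {t}"
  from OpInv.prems have st: "s \<in> qterms S" "t \<in> qterms S" by simp_all
  have cl: "F (?c u) \<in> qcarrier X" if "u \<in> qterms S" for u
    using F that by (auto simp: Hom_def qcarrier_presented)
  have "qop X (F (?c (OpInv s t))) (F (?c t)) = F (?c (Op (OpInv s t) t))"
    using F st by (auto simp: Hom_def qcarrier_presented simp flip: presented_quandle_op)
  also have "?c (Op (OpInv s t) t) = ?c s"
    using st by (intro equiv_class_eq[OF equiv_qcong] qcong.op_inv)
  finally have "F (?c (OpInv s t)) = inv_into (qcarrier X) (\<lambda>x. qop X x (F (?c t))) (F (?c s))"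
    using quandle_right_division(3)[OF X cl cl[OF st(2)], of "OpInv s t"] st by simp
  then show ?case using OpInv.IH st by simp
qed simp

text \<open>
  The universal property of a presentation.
\<close>

lemma bij_betw_Hom_presented:
  assumes X: "quandle X"
  shows "bij_betw (\<lambda>F. \<lambda>a\<in>S. F (qcong S R `` {Gen a}))
           (Hom (presented_quandle S R) X) (presentation_solutions S R X)"
  unfolding bij_betw_def
proof (intro conjI inj_onI equalityI subsetI)
  let ?c = "\<lambda>t. qcong S R `` {t}"
  fix F G
  assume FG: "F \<in> Hom (presented_quandle S R) X" "G \<in> Hom (presented_quandle S R) X"
    and eq: "(\<lambda>a\<in>S. F (?c (Gen a))) = (\<lambda>a\<in>S. G (?c (Gen a)))"
  show "F = G"
  proof (rule PiE_ext)
    show "F \<in> qcarrier (presented_quandle S R) \<rightarrow>\<^sub>E qcarrier X"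
      "G \<in> qcarrier (presented_quandle S R) \<rightarrow>\<^sub>E qcarrier X"
      using FG by (auto simp: Hom_def)
    fix A assume "A \<in> qcarrier (presented_quandle S R)"
    then show "F A = G A"
      using Hom_presented_qeval[OF X FG(1)] Hom_presented_qeval[OF X FG(2)] eq
      by (auto simp: qcarrier_presented)
  qed
next
  let ?c = "\<lambda>t. qcong S R `` {t}"
  fix g assume "g \<in> (\<lambda>F. \<lambda>a\<in>S. F (?c (Gen a))) ` Hom (presented_quandle S R) X"
  then obtain F where F: "F \<in> Hom (presented_quandle S R) X" and g: "g = (\<lambda>a\<in>S. F (?c (Gen a)))"
    by blast
  have "qeval X g s = qeval X g t" if "(s, t) \<in> R" "s \<in> qterms S" "t \<in> qterms S" for s t
    using equiv_class_eq[OF equiv_qcong qcong.rel[OF that]] that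
    unfolding g by (simp flip: Hom_presented_qeval[OF X F])
  moreover have "g \<in> S \<rightarrow>\<^sub>E qcarrier X"
    using F unfolding g by (auto simp: Hom_def qcarrier_presented)
  ultimately show "g \<in> presentation_solutions S R X"
    by (auto simp: presentation_solutions_def)
next
  let ?c = "\<lambda>t. qcong S R `` {t}"
  fix g assume g: "g \<in> presentation_solutions S R X"
  define F where "F = (\<lambda>A\<in>qcarrier (presented_quandle S R). the_elem (qeval X g ` A))"
  have F: "F (?c t) = qeval X g t" if "t \<in> qterms S" for t
  proof -
    have "qeval X g ` ?c t = {qeval X g t}"
      using qeval_qcong[OF X g] qcong.refl[OF that] by force
    then show ?thesis using that by (simp add: F_def qcarrier_presented)
  qed
  have "qeval X g t \<in> qcarrier X" if "t \<in> qterms S" for t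
    using g that by (intro qeval_closed[OF X]) (auto simp: presentation_solutions_def)
  then have "F \<in> Hom (presented_quandle S R) X"
    by (auto simp: Hom_def F qcarrier_presented presented_quandle_op)
       (auto simp: F_def qcarrier_presented)
  moreover have "g = (\<lambda>a\<in>S. F (?c (Gen a)))"
    using g by (auto simp: F presentation_solutions_def PiE_def extensional_def)
  ultimately show "g \<in> (\<lambda>F. \<lambda>a\<in>S. F (?c (Gen a))) ` Hom (presented_quandle S R) X"
    by blast
qed

section \<open>Colorings of a link diagram\<close>

text \<open>
  Coloring edges rather than arcs avoids the transitive closure in the definition of an arc: being
  constant along arcs becomes a condition at each crossing.
\<close>

definition colorings ::
  "('c, 'e) diagram \<Rightarrow> ('c \<Rightarrow> corner \<Rightarrow> bool) \<Rightarrow> 'x quandle_struct \<Rightarrow> ('e \<Rightarrow> 'x) set" where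
  "colorings D out X = {\<phi> \<in> edges D \<rightarrow>\<^sub>E qcarrier X. \<forall>c\<in>crossings D. \<forall>k. overpass D c k \<longrightarrow>
     \<phi> (edge D c (opposite k)) = \<phi> (edge D c k) \<and>
     (out c k \<longrightarrow> \<phi> (edge D c (ccw k)) = qop X (\<phi> (edge D c (cw k))) (\<phi> (edge D c k)))}"

lemma opposite_opposite [simp]: "opposite (opposite k) = k"
  by (cases k) simp_all

lemma edge_in_edges [simp]: "c \<in> crossings D \<Longrightarrow> edge D c k \<in> edges D"
  by (auto simp: edges_def)

lemma arc_of_in_arcs [simp]: "e \<in> edges D \<Longrightarrow> arc_of D e \<in> arcs D"
  by (auto simp: arcs_def)

text \<open>
  Reachability along overpasses is symmetric because both corners of an overpass are upper ones, so
  the two edges there generate the same arc.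
\<close>

lemma arc_of_over:
  assumes "link_diagram D" "c \<in> crossings D" "overpass D c k"
  shows "arc_of D (edge D c (opposite k)) = arc_of D (edge D c k)"
proof -
  have "(edge D c k, edge D c (opposite k)) \<in> over_rel D"
    "(edge D c (opposite k), edge D c (opposite (opposite k))) \<in> over_rel D"
    unfolding over_rel_def using assms unfolding link_diagram_def by blast+
  then show ?thesis
    unfolding arc_of_def by (auto intro: converse_rtrancl_into_rtrancl)
qed

lemma coloring_constant_on_arc:
  assumes "\<phi> \<in> colorings D out X" "e' \<in> arc_of D e"
  shows "\<phi> e' = \<phi> e"
proof -
  have "(e, e') \<in> (over_rel D)\<^sup>*" using assms(2) by (simp add: arc_of_def)
  then show ?thesis
    by induction (use assms(1) in \<open>auto simp: over_rel_def colorings_def\<close>)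
qed

text \<open>
  An assignment to the arcs is pulled back to edges; conversely a coloring is constant on each
  arc, and the value of the assignment there is the single color of its edges.
\<close>

lemma bij_betw_solutions_colorings:
  assumes D: "link_diagram D"
  shows "bij_betw (\<lambda>g. \<lambda>e\<in>edges D. g (arc_of D e))
           (presentation_solutions (arcs D) (crossing_relations D out) X) (colorings D out X)"
  unfolding bij_betw_def
proof (intro conjI inj_onI equalityI subsetI)
  fix g g'
  assume "g \<in> presentation_solutions (arcs D) (crossing_relations D out) X"
    "g' \<in> presentation_solutions (arcs D) (crossing_relations D out) X"
    and eq: "(\<lambda>e\<in>edges D. g (arc_of D e)) = (\<lambda>e\<in>edges D. g' (arc_of D e))"
  then have g: "g \<in> arcs D \<rightarrow>\<^sub>E qcarrier X" "g' \<in> arcs D \<rightarrow>\<^sub>E qcarrier X"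
    by (auto simp: presentation_solutions_def)
  have "g (arc_of D e) = g' (arc_of D e)" if "e \<in> edges D" for e
    using fun_cong[OF eq, of e] that by simp
  then show "g = g'"
    by (intro PiE_ext[OF g]) (auto simp: arcs_def)
next
  fix \<phi>
  assume "\<phi> \<in> (\<lambda>g. \<lambda>e\<in>edges D. g (arc_of D e)) `
    presentation_solutions (arcs D) (crossing_relations D out) X"
  then obtain g where g: "g \<in> presentation_solutions (arcs D) (crossing_relations D out) X"
    and \<phi>: "\<phi> = (\<lambda>e\<in>edges D. g (arc_of D e))"
    by blast
  have "\<phi> (edge D c (ccw k)) = qop X (\<phi> (edge D c (cw k))) (\<phi> (edge D c k))"
    if "c \<in> crossings D" "overpass D c k" "out c k" for c k
  proof -
    have "(Gen (arc_of D (edge D c (ccw k))),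
       Op (Gen (arc_of D (edge D c (cw k)))) (Gen (arc_of D (edge D c k))))
       \<in> crossing_relations D out"
      using that by (auto simp: crossing_relations_def)
    then show ?thesis
      using g that unfolding \<phi> presentation_solutions_def by fastforce
  qed
  moreover have "\<phi> \<in> edges D \<rightarrow>\<^sub>E qcarrier X"
    using g unfolding \<phi> by (auto simp: presentation_solutions_def)
  ultimately show "\<phi> \<in> colorings D out X"
    by (auto simp: colorings_def \<phi> arc_of_over[OF D])
next
  fix \<phi> assume \<phi>: "\<phi> \<in> colorings D out X"
  define g where "g = (\<lambda>A\<in>arcs D. the_elem (\<phi> ` A))"
  have g: "g (arc_of D e) = \<phi> e" if "e \<in> edges D" for e
  proof -
    have "e \<in> arc_of D e" by (simp add: arc_of_def)
    moreover have "\<phi> ` arc_of D e = (\<lambda>_. \<phi> e) ` arc_of D e"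
      by (intro image_cong HOL.refl coloring_constant_on_arc[OF \<phi>])
    ultimately have "\<phi> ` arc_of D e = {\<phi> e}" by auto
    then show ?thesis using that by (simp add: g_def)
  qed
  have "g \<in> arcs D \<rightarrow>\<^sub>E qcarrier X"
    using \<phi> by (auto simp: arcs_def g colorings_def) (auto simp: g_def arcs_def)
  moreover have "qeval X g s = qeval X g t" if "(s, t) \<in> crossing_relations D out" for s t
    using that \<phi> by (auto simp: crossing_relations_def g colorings_def)
  ultimately have "g \<in> presentation_solutions (arcs D) (crossing_relations D out) X"
    by (auto simp: presentation_solutions_def)
  moreover have "\<phi> = (\<lambda>e\<in>edges D. g (arc_of D e))"
    using \<phi> by (auto simp: g colorings_def PiE_def extensional_def)
  ultimately show "\<phi> \<in> (\<lambda>g. \<lambda>e\<in>edges D. g (arc_of D e)) `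
      presentation_solutions (arcs D) (crossing_relations D out) X"
    by blast
qed

lemma card_Hom_fundamental_quandle:
  assumes "link_diagram D" "quandle X"
  shows "card (Hom (fundamental_quandle D out) X) = card (colorings D out X)"
  unfolding fundamental_quandle_def
  using bij_betw_same_card[OF bij_betw_Hom_presented[OF assms(2)]]
    bij_betw_same_card[OF bij_betw_solutions_colorings[OF assms(1)]] by metis

section \<open>Colorings by dihedral quandles\<close>

text \<open>
  The Fox \<open>n\<close>-colorings of the unoriented diagram.
\<close>

definition fox_colorings :: "nat \<Rightarrow> ('c, 'e) diagram \<Rightarrow> ('e \<Rightarrow> int) set" where
  "fox_colorings n D = {\<phi> \<in> edges D \<rightarrow>\<^sub>E {0..<int n}. \<forall>c\<in>crossings D. \<forall>k. overpass D c k \<longrightarrow>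
     \<phi> (edge D c (opposite k)) = \<phi> (edge D c k) \<and>
     [\<phi> (edge D c (ccw k)) + \<phi> (edge D c (cw k)) = 2 * \<phi> (edge D c k)] (mod int n)}"

text \<open>
  The oriented relation is imposed only at the corner where the upper strand leaves. Turning to the
  opposite corner exchanges the two lower edges, which does not affect the Fox condition, and one of
  the two corners is the outgoing one.
\<close>

lemma colorings_dihedral_quandle:
  assumes D: "link_diagram D" and out: "orientation D out"
  shows "colorings D out (dihedral_quandle n) = fox_colorings n D"
proof (intro set_eqI)
  fix \<phi> :: "'b \<Rightarrow> int"
  have op: "qop (dihedral_quandle n) x y = z \<longleftrightarrow> [z + x = 2 * y] (mod int n)"
    if "z \<in> {0..<int n}" for x y z
  proof -
    have "[z + x = 2 * y] (mod int n) \<longleftrightarrow> [z = 2 * y - x] (mod int n)"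
      by (simp add: cong_iff_dvd_diff algebra_simps)
    also have "\<dots> \<longleftrightarrow> z = (2 * y - x) mod int n"
      using that by (simp add: cong_def)
    finally show ?thesis by (auto simp: dihedral_quandle_simps)
  qed
  have corner: "ccw (opposite k) = cw k" "cw (opposite k) = ccw k" for k
    by (cases k; simp)+
  have "(\<forall>c\<in>crossings D. \<forall>k. overpass D c k \<longrightarrow> \<phi> (edge D c (opposite k)) = \<phi> (edge D c k) \<and>
       (out c k \<longrightarrow> [\<phi> (edge D c (ccw k)) + \<phi> (edge D c (cw k)) = 2 * \<phi> (edge D c k)] (mod int n)))
    \<longleftrightarrow> (\<forall>c\<in>crossings D. \<forall>k. overpass D c k \<longrightarrow> \<phi> (edge D c (opposite k)) = \<phi> (edge D c k) \<and>
       [\<phi> (edge D c (ccw k)) + \<phi> (edge D c (cw k)) = 2 * \<phi> (edge D c k)] (mod int n))"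
    (is "?L \<longleftrightarrow> ?R")
  proof
    assume L: ?L
    show ?R
    proof (intro ballI allI impI conjI)
      fix c k assume c: "c \<in> crossings D" "overpass D c k"
      then show "\<phi> (edge D c (opposite k)) = \<phi> (edge D c k)" using L by blast
      have "overpass D c (opposite k)" using c D by (auto simp: link_diagram_def)
      moreover have "out c k \<or> out c (opposite k)" using c out by (auto simp: orientation_def)
      ultimately show "[\<phi> (edge D c (ccw k)) + \<phi> (edge D c (cw k)) = 2 * \<phi> (edge D c k)] (mod int n)"
        using L c by (metis corner add.commute)
    qed
  qed blast
  moreover have "(\<phi> (edge D c (ccw k)) =
        qop (dihedral_quandle n) (\<phi> (edge D c (cw k))) (\<phi> (edge D c k))) \<longleftrightarrow>
      [\<phi> (edge D c (ccw k)) + \<phi> (edge D c (cw k)) = 2 * \<phi> (edge D c k)] (mod int n)"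
    if "\<phi> \<in> edges D \<rightarrow>\<^sub>E {0..<int n}" "c \<in> crossings D" for c k
  proof -
    have "\<phi> (edge D c (ccw k)) \<in> {0..<int n}"
      using that by (meson PiE_mem edge_in_edges)
    from op[OF this] show ?thesis by metis
  qed
  ultimately show "\<phi> \<in> colorings D out (dihedral_quandle n) \<longleftrightarrow> \<phi> \<in> fox_colorings n D"
    unfolding colorings_def fox_colorings_def mem_Collect_eq dihedral_quandle_simps(1)
    by (intro conj_cong HOL.refl) (simp cong: ball_cong)
qed

section \<open>Colorings of a pretzel diagram\<close>

lemma crossings_pretzel:
  "(i, k) \<in> crossings (pretzel ps) \<longleftrightarrow> i < length ps \<and> k < nat \<bar>ps ! i\<bar>"
  by (simp add: pretzel_def)

lemma edges_pretzel:
  assumes "\<forall>p\<in>set ps. p \<noteq> 0"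
  shows "edges (pretzel ps) =
    {left_edge ps i k | i k. i < length ps \<and> k \<le> nat \<bar>ps ! i\<bar>} \<union>
    {right_edge ps i k | i k. i < length ps \<and> k \<le> nat \<bar>ps ! i\<bar>}" (is "_ = ?E")
proof (intro equalityI subsetI)
  fix e assume "e \<in> edges (pretzel ps)"
  then obtain i k q where "i < length ps" "k < nat \<bar>ps ! i\<bar>" "e = edge (pretzel ps) (i, k) q"
    by (auto simp: edges_def crossings_pretzel)
  then show "e \<in> ?E"
    by (cases q) (fastforce simp: pretzel_def intro: less_imp_le Suc_leI)+
next
  fix e assume "e \<in> ?E"
  then obtain i k where i: "i < length ps" and k: "k \<le> nat \<bar>ps ! i\<bar>"
    and e: "e = left_edge ps i k \<or> e = right_edge ps i k"
    by blast
  have "nat \<bar>ps ! i\<bar> > 0" using assms i by (auto simp: all_set_conv_all_nth)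
  show "e \<in> edges (pretzel ps)"
  proof (cases k)
    case 0
    then have "e = edge (pretzel ps) (i, 0) NW \<or> e = edge (pretzel ps) (i, 0) NE"
      using e by (auto simp: pretzel_def)
    then show ?thesis using i \<open>nat \<bar>ps ! i\<bar> > 0\<close>
      by (metis edge_in_edges crossings_pretzel)
  next
    case (Suc l)
    then have "e = edge (pretzel ps) (i, l) SW \<or> e = edge (pretzel ps) (i, l) SE"
      using e by (auto simp: pretzel_def)
    then show ?thesis using i k Suc
      by (metis edge_in_edges crossings_pretzel Suc_le_lessD)
  qed
qed

text \<open>
  The upper strand keeps its color while it moves to the other side of the column, and the lower one
  is reflected in it. If \<open>l\<close> and \<open>r\<close> are the colors above a positive crossing and \<open>d = r - l\<close>, the
  colors below it are \<open>r = l + d\<close> and \<open>2 * r - l = r + d\<close>; a negative crossing subtracts \<open>d\<close>.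
\<close>

lemma fox_colorings_pretzel_step:
  assumes nz: "\<forall>p\<in>set ps. p \<noteq> 0"
    and \<phi>: "\<phi> \<in> edges (pretzel ps) \<rightarrow>\<^sub>E {0..<int n}"
  shows "\<phi> \<in> fox_colorings n (pretzel ps) \<longleftrightarrow>
    (\<forall>i<length ps. \<forall>k<nat \<bar>ps ! i\<bar>.
       [\<phi> (left_edge ps i (Suc k)) = \<phi> (left_edge ps i k)
          + sgn (ps ! i) * (\<phi> (right_edge ps i k) - \<phi> (left_edge ps i k))] (mod int n) \<and>
       [\<phi> (right_edge ps i (Suc k)) = \<phi> (right_edge ps i k)
          + sgn (ps ! i) * (\<phi> (right_edge ps i k) - \<phi> (left_edge ps i k))] (mod int n))"
    (is "_ \<longleftrightarrow> (\<forall>i<_. \<forall>k<_. ?step i k)")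
proof -
  let ?D = "pretzel ps"
  have "(\<forall>q. overpass ?D (i, k) q \<longrightarrow>
       \<phi> (edge ?D (i, k) (opposite q)) = \<phi> (edge ?D (i, k) q) \<and>
       [\<phi> (edge ?D (i, k) (ccw q)) + \<phi> (edge ?D (i, k) (cw q)) = 2 * \<phi> (edge ?D (i, k) q)] (mod int n))
    \<longleftrightarrow> ?step i k" if i: "i < length ps" and k: "k < nat \<bar>ps ! i\<bar>" for i k
  proof -
    let ?L = "left_edge ps i" and ?R = "right_edge ps i"
    have corners: "(\<forall>q. P q) \<longleftrightarrow> P NE \<and> P NW \<and> P SW \<and> P SE" for P
      by (metis corner.exhaust)
    \<comment> \<open>Colors are representatives in the range of residues, so congruent ones are equal.\<close>
    have eq: "\<phi> e = \<phi> e' \<longleftrightarrow> [\<phi> e = \<phi> e'] (mod int n)"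
      if "e \<in> edges ?D" "e' \<in> edges ?D" for e e'
    proof -
      have "\<phi> e \<in> {0..<int n}" "\<phi> e' \<in> {0..<int n}" using \<phi> that by blast+
      then show ?thesis by (simp add: cong_def)
    qed
    have E: "?L k \<in> edges ?D" "?L (Suc k) \<in> edges ?D" "?R k \<in> edges ?D" "?R (Suc k) \<in> edges ?D"
      unfolding edges_pretzel[OF nz] using i less_imp_le[OF k] Suc_leI[OF k] by blast+
    have pos: "[\<phi> (?L k) + \<phi> (?R (Suc k)) = 2 * \<phi> (?R k)] (mod int n) \<longleftrightarrow>
        [\<phi> (?R (Suc k)) = \<phi> (?R k) + 1 * (\<phi> (?R k) - \<phi> (?L k))] (mod int n)"
      by (simp add: cong_iff_dvd_diff algebra_simps)
    have neg: "[\<phi> (?R k) + \<phi> (?L (Suc k)) = 2 * \<phi> (?L k)] (mod int n) \<longleftrightarrow>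
        [\<phi> (?L (Suc k)) = \<phi> (?L k) + (-1) * (\<phi> (?R k) - \<phi> (?L k))] (mod int n)"
      by (simp add: cong_iff_dvd_diff algebra_simps)
    have "ps ! i \<noteq> 0" using nz i by (auto simp: all_set_conv_all_nth)
    then consider "ps ! i > 0" | "ps ! i < 0" by linarith
    then show ?thesis
    proof cases
      case 1
      have "(\<forall>q. overpass ?D (i, k) q \<longrightarrow>
          \<phi> (edge ?D (i, k) (opposite q)) = \<phi> (edge ?D (i, k) q) \<and>
          [\<phi> (edge ?D (i, k) (ccw q)) + \<phi> (edge ?D (i, k) (cw q)) = 2 * \<phi> (edge ?D (i, k) q)] (mod int n))
        \<longleftrightarrow> \<phi> (?L (Suc k)) = \<phi> (?R k) \<and> [\<phi> (?L k) + \<phi> (?R (Suc k)) = 2 * \<phi> (?R k)] (mod int n)"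
        using 1 unfolding corners by (auto simp: pretzel_def add.commute)
      also have "\<dots> \<longleftrightarrow> ?step i k"
        using 1 unfolding pos eq[OF E(2,3)] by simp
      finally show ?thesis .
    next
      case 2
      have "(\<forall>q. overpass ?D (i, k) q \<longrightarrow>
          \<phi> (edge ?D (i, k) (opposite q)) = \<phi> (edge ?D (i, k) q) \<and>
          [\<phi> (edge ?D (i, k) (ccw q)) + \<phi> (edge ?D (i, k) (cw q)) = 2 * \<phi> (edge ?D (i, k) q)] (mod int n))
        \<longleftrightarrow> \<phi> (?R (Suc k)) = \<phi> (?L k) \<and> [\<phi> (?R k) + \<phi> (?L (Suc k)) = 2 * \<phi> (?L k)] (mod int n)"
        using 2 unfolding corners by (auto simp: pretzel_def add.commute)
      also have "\<dots> \<longleftrightarrow> ?step i k"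
        using 2 unfolding neg eq[OF E(4,1)] by auto
      finally show ?thesis .
    qed
  qed
  then show ?thesis
    using \<phi> unfolding fox_colorings_def by (auto simp: crossings_pretzel)
qed

text \<open>
  Both colors move by the same amount at each step, so their difference stays the same and the values
  along the column form arithmetic progressions.
\<close>

lemma column_values:
  fixes L R :: "nat \<Rightarrow> int"
  assumes "\<And>k. k < N \<Longrightarrow> [L (Suc k) = L k + s * (R k - L k)] (mod m)"
    and "\<And>k. k < N \<Longrightarrow> [R (Suc k) = R k + s * (R k - L k)] (mod m)"
    and "k \<le> N"
  shows "[L k = L 0 + int k * s * (R 0 - L 0)] (mod m) \<and> [R k = R 0 + int k * s * (R 0 - L 0)] (mod m)"
  using assms(3)
proof (induction k)
  case (Suc k)
  then have IH: "[L k = L 0 + int k * s * (R 0 - L 0)] (mod m)"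
    "[R k = R 0 + int k * s * (R 0 - L 0)] (mod m)" by simp_all
  have d: "[s * (R k - L k) = s * (R 0 - L 0)] (mod m)"
    using cong_scalar_left[OF cong_diff[OF IH(2,1)], of s] by simp
  have "[L (Suc k) = L 0 + int k * s * (R 0 - L 0) + s * (R 0 - L 0)] (mod m)"
    using cong_trans[OF assms(1) cong_add[OF IH(1) d]] Suc.prems by simp
  moreover have "[R (Suc k) = R 0 + int k * s * (R 0 - L 0) + s * (R 0 - L 0)] (mod m)"
    using cong_trans[OF assms(2) cong_add[OF IH(2) d]] Suc.prems by simp
  ultimately show ?case by (simp add: algebra_simps)
qed simp

lemma fox_colorings_pretzel_iff:
  assumes nz: "\<forall>p\<in>set ps. p \<noteq> 0"
    and \<phi>: "\<phi> \<in> edges (pretzel ps) \<rightarrow>\<^sub>E {0..<int n}"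
  shows "\<phi> \<in> fox_colorings n (pretzel ps) \<longleftrightarrow>
    (\<forall>i<length ps. \<forall>k\<le>nat \<bar>ps ! i\<bar>.
       [\<phi> (left_edge ps i k) = \<phi> (Top i) + int k * sgn (ps ! i)
          * (\<phi> (Top (Suc i mod length ps)) - \<phi> (Top i))] (mod int n) \<and>
       [\<phi> (right_edge ps i k) = \<phi> (Top (Suc i mod length ps)) + int k * sgn (ps ! i)
          * (\<phi> (Top (Suc i mod length ps)) - \<phi> (Top i))] (mod int n))"
    (is "_ \<longleftrightarrow> (\<forall>i<_. \<forall>k\<le>_. ?val i k)")
proof
  assume "\<phi> \<in> fox_colorings n (pretzel ps)"
  note step = this[unfolded fox_colorings_pretzel_step[OF assms]]
  show "\<forall>i<length ps. \<forall>k\<le>nat \<bar>ps ! i\<bar>. ?val i k"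
  proof (intro allI impI)
    fix i k assume "i < length ps" "k \<le> nat \<bar>ps ! i\<bar>"
    then show "?val i k"
      using column_values[of "nat \<bar>ps ! i\<bar>" "\<lambda>k. \<phi> (left_edge ps i k)" "sgn (ps ! i)"
          "\<lambda>k. \<phi> (right_edge ps i k)" "int n" k] step
      by (simp add: left_edge_def[of _ _ 0] right_edge_def[of _ _ 0])
  qed
next
  assume val: "\<forall>i<length ps. \<forall>k\<le>nat \<bar>ps ! i\<bar>. ?val i k"
  show "\<phi> \<in> fox_colorings n (pretzel ps)"
    unfolding fox_colorings_pretzel_step[OF assms]
  proof (intro allI impI)
    fix i k assume i: "i < length ps" and k: "k < nat \<bar>ps ! i\<bar>"
    let ?x = "\<phi> (Top i)" and ?d = "\<phi> (Top (Suc i mod length ps)) - \<phi> (Top i)"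
    let ?s = "sgn (ps ! i)" and ?L = "\<lambda>k. \<phi> (left_edge ps i k)" and ?R = "\<lambda>k. \<phi> (right_edge ps i k)"
    have v: "?val i k" "?val i (Suc k)"
      by (rule val[rule_format, OF i less_imp_le[OF k]] val[rule_format, OF i Suc_leI[OF k]])+
    have d: "[?s * (?R k - ?L k) = ?s * ?d] (mod int n)"
      using cong_scalar_left[OF cong_diff[OF conjunct2[OF v(1)] conjunct1[OF v(1)]], of ?s] by simp
    have suc: "x + int (Suc k) * ?s * ?d = x + int k * ?s * ?d + ?s * ?d" for x
      by (simp add: algebra_simps)
    have "[?L k + ?s * (?R k - ?L k) = ?L (Suc k)] (mod int n)"
      using cong_trans[OF cong_add[OF conjunct1[OF v(1)] d] cong_sym[OF conjunct1[OF v(2), unfolded suc]]] .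
    moreover have "[?R k + ?s * (?R k - ?L k) = ?R (Suc k)] (mod int n)"
      using cong_trans[OF cong_add[OF conjunct2[OF v(1)] d] cong_sym[OF conjunct2[OF v(2), unfolded suc]]] .
    ultimately show "[?L (Suc k) = ?L k + ?s * (?R k - ?L k)] (mod int n) \<and>
        [?R (Suc k) = ?R k + ?s * (?R k - ?L k)] (mod int n)"
      by (simp add: cong_sym)
  qed
qed

text \<open>
  \<open>x i\<close> is the color of the top edge to the left of column \<open>i\<close>, and \<open>x (Suc i mod length ps)\<close> the one to
  its right. Asking that the shifts of all columns agree is equivalent to asking it for neighbouring
  columns, which is what the bottom edges require, and is symmetric in the columns.
\<close>

definition top_labellings :: "nat \<Rightarrow> int list \<Rightarrow> (nat \<Rightarrow> int) set" where
  "top_labellings n ps = {x \<in> {..<length ps} \<rightarrow>\<^sub>E {0..<int n}. \<forall>i<length ps. \<forall>j<length ps.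
     [ps ! i * (x (Suc i mod length ps) - x i) = ps ! j * (x (Suc j mod length ps) - x j)] (mod int n)}"

lemma cong_cyclic_chain:
  assumes "\<And>i. i < m \<Longrightarrow> [u i = u (Suc i mod m)] (mod l)" "i < m" "j < m"
  shows "[u i = u j] (mod (l::int))"
proof -
  have "[u 0 = u i] (mod l)" if "i < m" for i
    using that
  proof (induction i)
    case (Suc i)
    then show ?case using assms(1)[of i] by (auto intro: cong_trans)
  qed simp
  then show ?thesis using assms(2,3) by (meson cong_sym cong_trans)
qed

text \<open>
  All edges are colored by the arithmetic progressions that start at the top, and \<open>Bottom i\<close> is the only
  kind of edge below the top that is shared by two columns. Injectivity holds because the top colors
  fix the progressions; a labelling of the top edges extends because its shifts agree at the bottom.
\<close>

lemma bij_betw_fox_colorings_pretzel: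
  assumes nz: "\<forall>p\<in>set ps. p \<noteq> 0" and n: "n > 0"
  shows "bij_betw (\<lambda>\<phi>. \<lambda>i\<in>{..<length ps}. \<phi> (Top i))
           (fox_colorings n (pretzel ps)) (top_labellings n ps)"
  unfolding bij_betw_def
proof (intro conjI inj_onI equalityI subsetI)
  let ?m = "length ps"
  fix \<phi> \<psi>
  assume fox: "\<phi> \<in> fox_colorings n (pretzel ps)" "\<psi> \<in> fox_colorings n (pretzel ps)"
    and eq: "(\<lambda>i\<in>{..<?m}. \<phi> (Top i)) = (\<lambda>i\<in>{..<?m}. \<psi> (Top i))"
  then have E: "\<phi> \<in> edges (pretzel ps) \<rightarrow>\<^sub>E {0..<int n}" "\<psi> \<in> edges (pretzel ps) \<rightarrow>\<^sub>E {0..<int n}"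
    by (auto simp: fox_colorings_def)
  have top: "\<phi> (Top i) = \<psi> (Top i)" if "i < ?m" for i
    using fun_cong[OF eq, of i] that by simp
  show "\<phi> = \<psi>"
  proof (rule PiE_ext[OF E])
    fix e assume e: "e \<in> edges (pretzel ps)"
    then obtain i k where i: "i < ?m" "k \<le> nat \<bar>ps ! i\<bar>"
      and "e = left_edge ps i k \<or> e = right_edge ps i k"
      unfolding edges_pretzel[OF nz] by blast
    moreover have "\<phi> (Top (Suc i mod ?m)) = \<psi> (Top (Suc i mod ?m))"
      using i(1) by (intro top mod_less_divisor) linarith
    moreover note fox[unfolded fox_colorings_pretzel_iff[OF nz E(1)]
        fox_colorings_pretzel_iff[OF nz E(2)], rule_format, OF i]
    ultimately have "[\<phi> e = \<psi> e] (mod int n)"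
      unfolding top[OF i(1)] by (elim disjE; simp only: cong_def)
    moreover have "\<phi> e \<in> {0..<int n}" "\<psi> e \<in> {0..<int n}" using E e by blast+
    ultimately show "\<phi> e = \<psi> e" by (simp add: cong_def)
  qed
next
  let ?m = "length ps"
  fix x assume "x \<in> (\<lambda>\<phi>. \<lambda>i\<in>{..<?m}. \<phi> (Top i)) ` fox_colorings n (pretzel ps)"
  then obtain \<phi> where fox: "\<phi> \<in> fox_colorings n (pretzel ps)"
    and x: "x = (\<lambda>i\<in>{..<?m}. \<phi> (Top i))" by blast
  then have E: "\<phi> \<in> edges (pretzel ps) \<rightarrow>\<^sub>E {0..<int n}"
    by (auto simp: fox_colorings_def)
  have "Top i \<in> edges (pretzel ps)" if "i < ?m" for i
    using that unfolding edges_pretzel[OF nz] by (force simp: left_edge_def)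
  then have "x \<in> {..<?m} \<rightarrow>\<^sub>E {0..<int n}"
    using E unfolding x by auto
  let ?s = "\<lambda>i. Suc i mod ?m"
  \<comment> \<open>The progressions evaluated at the last level, where the shift is the whole of \<open>ps ! i * d\<close>.\<close>
  have bot: "[\<phi> (Bottom i) = x i + ps ! i * (x (?s i) - x i)] (mod int n) \<and>
      [\<phi> (Bottom (?s i)) = x (?s i) + ps ! i * (x (?s i) - x i)] (mod int n)" if i: "i < ?m" for i
  proof -
    have "?s i < ?m" using i by (intro mod_less_divisor) linarith
    moreover have "ps ! i \<noteq> 0" using nz i by (auto simp: all_set_conv_all_nth)
    moreover have "int (nat \<bar>ps ! i\<bar>) * sgn (ps ! i) = ps ! i" by (simp add: abs_mult_sgn)
    ultimately show ?thesis
      using fox[unfolded fox_colorings_pretzel_iff[OF nz E], rule_format, OF i order_refl] i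
      by (simp add: left_edge_def right_edge_def x)
  qed
  have "[ps ! i * (x (?s i) - x i) = ps ! ?s i * (x (?s (?s i)) - x (?s i))] (mod int n)"
    if i: "i < ?m" for i
  proof -
    have "?s i < ?m" using i by (intro mod_less_divisor) linarith
    from cong_trans[OF cong_sym[OF conjunct2[OF bot[OF i]]] conjunct1[OF bot[OF this]]]
    show ?thesis by (simp add: cong_add_lcancel)
  qed
  then have "[ps ! i * (x (?s i) - x i) = ps ! j * (x (?s j) - x j)] (mod int n)"
    if "i < ?m" "j < ?m" for i j
    using cong_cyclic_chain[of ?m "\<lambda>i. ps ! i * (x (?s i) - x i)" "int n" i j] that by blast
  with \<open>x \<in> {..<?m} \<rightarrow>\<^sub>E {0..<int n}\<close> show "x \<in> top_labellings n ps"
    by (simp add: top_labellings_def)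
next
  let ?m = "length ps"
  fix x assume x: "x \<in> top_labellings n ps"
  let ?s = "\<lambda>i. Suc i mod ?m"
  define d where "d i = x (?s i) - x i" for i
  \<comment> \<open>\<open>Bottom i\<close> gets its color from the column to its right; \<open>vals\<close> shows that the left one agrees.\<close>
  define \<psi> where "\<psi> e = (case e of Top i \<Rightarrow> x i | Bottom i \<Rightarrow> x i + ps ! i * d i
    | InnerL i k \<Rightarrow> x i + int k * sgn (ps ! i) * d i
    | InnerR i k \<Rightarrow> x (?s i) + int k * sgn (ps ! i) * d i)" for e
  define \<phi> where "\<phi> = (\<lambda>e\<in>edges (pretzel ps). \<psi> e mod int n)"
  have E: "\<phi> \<in> edges (pretzel ps) \<rightarrow>\<^sub>E {0..<int n}"
    using n by (auto simp: \<phi>_def)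
  have Top: "\<phi> (Top i) = x i" if "i < ?m" for i
  proof -
    have "Top i \<in> edges (pretzel ps)"
      using that unfolding edges_pretzel[OF nz] by (force simp: left_edge_def)
    moreover have "x i \<in> {0..<int n}" using x that by (auto simp: top_labellings_def)
    ultimately show ?thesis by (simp add: \<phi>_def \<psi>_def)
  qed
  have vals: "[\<psi> (left_edge ps i k) = x i + int k * sgn (ps ! i) * d i] (mod int n) \<and>
      [\<psi> (right_edge ps i k) = x (?s i) + int k * sgn (ps ! i) * d i] (mod int n)"
    if i: "i < ?m" and k: "k \<le> nat \<bar>ps ! i\<bar>" for i k
  proof -
    have "?s i < ?m" using i by (intro mod_less_divisor) linarith
    with x i have "[ps ! ?s i * d (?s i) = ps ! i * d i] (mod int n)"
      unfolding top_labellings_def d_def by blast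
    moreover have "int (nat \<bar>ps ! i\<bar>) * sgn (ps ! i) = ps ! i" by (simp add: abs_mult_sgn)
    ultimately show ?thesis
      by (auto simp: left_edge_def right_edge_def \<psi>_def cong_add_lcancel)
  qed
  have "\<phi> \<in> fox_colorings n (pretzel ps)"
    unfolding fox_colorings_pretzel_iff[OF nz E]
  proof (intro allI impI)
    fix i k assume i: "i < ?m" and k: "k \<le> nat \<bar>ps ! i\<bar>"
    then have "left_edge ps i k \<in> edges (pretzel ps)" "right_edge ps i k \<in> edges (pretzel ps)"
      unfolding edges_pretzel[OF nz] by blast+
    then have "[\<phi> (left_edge ps i k) = \<psi> (left_edge ps i k)] (mod int n)"
      "[\<phi> (right_edge ps i k) = \<psi> (right_edge ps i k)] (mod int n)"
      by (simp_all add: \<phi>_def cong_def)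
    moreover have "?s i < ?m" using i by (intro mod_less_divisor) linarith
    ultimately show "[\<phi> (left_edge ps i k) = \<phi> (Top i) + int k * sgn (ps ! i)
          * (\<phi> (Top (?s i)) - \<phi> (Top i))] (mod int n) \<and>
       [\<phi> (right_edge ps i k) = \<phi> (Top (?s i)) + int k * sgn (ps ! i)
          * (\<phi> (Top (?s i)) - \<phi> (Top i))] (mod int n)"
      using vals[OF i k] i by (simp add: Top flip: d_def) (blast intro: cong_trans)
  qed
  moreover have "x = (\<lambda>i\<in>{..<?m}. \<phi> (Top i))"
    using x by (auto simp: Top top_labellings_def PiE_def extensional_def)
  ultimately show "x \<in> (\<lambda>\<phi>. \<lambda>i\<in>{..<?m}. \<phi> (Top i)) ` fox_colorings n (pretzel ps)"
    by blast
qed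

section \<open>Counting the labellings\<close>

definition closed_differences :: "nat \<Rightarrow> int list \<Rightarrow> (nat \<Rightarrow> int) set" where
  "closed_differences n ps = {d \<in> {..<length ps} \<rightarrow>\<^sub>E {0..<int n}.
     [(\<Sum>i<length ps. d i) = 0] (mod int n) \<and>
     (\<forall>i<length ps. \<forall>j<length ps. [ps ! i * d i = ps ! j * d j] (mod int n))}"

lemma sum_cyclic_shift: "(\<Sum>i<m. x (Suc i mod m)) = (\<Sum>i<m. (x i :: int))"
proof (cases m)
  case (Suc l)
  have "(\<Sum>i<Suc l. x (Suc i mod Suc l)) = (\<Sum>i<l. x (Suc i mod Suc l)) + x 0" by simp
  also have "(\<Sum>i<l. x (Suc i mod Suc l)) = (\<Sum>i<l. x (Suc i))"
    by (intro sum.cong HOL.refl) simp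
  also have "\<dots> + x 0 = (\<Sum>i<Suc l. x i)"
    by (simp only: sum.lessThan_Suc_shift add.commute)
  finally show ?thesis using Suc by simp
qed simp

text \<open>
  A labelling around a cycle is the same as a starting value together with differences that sum to
  zero: labels are recovered as partial sums, and the last difference closes the cycle.
\<close>

lemma bij_betw_top_labellings:
  assumes n: "n > 0" and ps: "ps \<noteq> []"
  shows "bij_betw
    (\<lambda>x. (x 0, \<lambda>i\<in>{..<length ps}. (x (Suc i mod length ps) - x i) mod int n))
    (top_labellings n ps) ({0..<int n} \<times> closed_differences n ps)"
proof -
  let ?m = "length ps" and ?s = "\<lambda>i. Suc i mod length ps"
  define \<Phi> where "\<Phi> x = (x 0, \<lambda>i\<in>{..<?m}. (x (?s i) - x i) mod int n)" for x :: "nat \<Rightarrow> int"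
  define \<Psi> where "\<Psi> td = (\<lambda>i\<in>{..<?m}. (fst td + (\<Sum>j<i. snd td j)) mod int n)"
    for td :: "int \<times> (nat \<Rightarrow> int)"
  have m: "?m > 0" and s: "?s i < ?m" for i
    using ps by simp_all
  have left: "\<Psi> (\<Phi> x) = x" if x: "x \<in> top_labellings n ps" for x
  proof
    fix i
    show "\<Psi> (\<Phi> x) i = x i"
    proof (cases "i < ?m")
      case True
      have tele: "(\<Sum>j<i. x (Suc j) - x j) = x i - x 0"
        by (rule sum_lessThan_telescope)
      have "(\<Sum>j<i. snd (\<Phi> x) j) = (\<Sum>j<i. (x (Suc j) - x j) mod int n)"
        using True by (intro sum.cong) (auto simp: \<Phi>_def)
      then have "\<Psi> (\<Phi> x) i = (x 0 + (\<Sum>j<i. (x (Suc j) - x j) mod int n)) mod int n"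
        using True by (simp add: \<Psi>_def) (simp add: \<Phi>_def)
      also have "\<dots> = x i mod int n"
        by (subst mod_add_right_eq[symmetric], subst mod_sum_eq) (simp add: tele mod_add_right_eq)
      also have "\<dots> = x i"
      proof -
        have "x i \<in> {0..<int n}" using x True by (auto simp: top_labellings_def)
        then show ?thesis by simp
      qed
      finally show ?thesis .
    next
      case False
      then show ?thesis
        using x by (auto simp: \<Psi>_def top_labellings_def PiE_def extensional_def)
    qed
  qed
  \<comment> \<open>For the last index the label returns to \<open>t\<close>, which is where the vanishing of the total is used.\<close>
  have diff: "[\<Psi> (t, d) (?s i) - \<Psi> (t, d) i = d i] (mod int n)"
    if d: "[(\<Sum>i<?m. d i) = 0] (mod int n)" and i: "i < ?m" for t d i
  proof -
    have val: "[\<Psi> (t, d) i = t + (\<Sum>j<i. d j)] (mod int n)" if "i < ?m" for i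
      using that by (simp add: \<Psi>_def)
    have "[\<Psi> (t, d) (?s i) = t + (\<Sum>j<Suc i. d j)] (mod int n)"
    proof (cases "Suc i = ?m")
      case True
      then have "[t + (\<Sum>j<Suc i. d j) = t + 0] (mod int n)"
        using d by (simp only: cong_add_lcancel)
      then show ?thesis
        using val[OF m] True by (metis cong_sym cong_trans lessThan_0 mod_self sum.empty)
    next
      case False
      then show ?thesis using val[of "Suc i"] i by simp
    qed
    from cong_diff[OF this val[OF i]] show ?thesis by simp
  qed
  have right: "\<Phi> (\<Psi> td) = td" if td: "td \<in> {0..<int n} \<times> closed_differences n ps" for td
  proof -
    obtain t d where [simp]: "td = (t, d)" by fastforce
    have t: "t \<in> {0..<int n}" and dE: "d \<in> {..<?m} \<rightarrow>\<^sub>E {0..<int n}"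
      and d: "[(\<Sum>i<?m. d i) = 0] (mod int n)"
      using td by (auto simp: closed_differences_def)
    have "snd (\<Phi> (\<Psi> td)) = d"
    proof
      fix i
      show "snd (\<Phi> (\<Psi> td)) i = d i"
      proof (cases "i < ?m")
        case True
        then have "d i \<in> {0..<int n}" using PiE_mem[OF dE] by blast
        then show ?thesis using diff[OF d True, of t] True by (simp add: \<Phi>_def cong_def)
      next
        case False
        then show ?thesis using dE by (auto simp: \<Phi>_def PiE_def extensional_def)
      qed
    qed
    moreover have "fst (\<Phi> (\<Psi> td)) = t"
      using t m by (simp add: \<Phi>_def \<Psi>_def)
    ultimately show ?thesis by (simp add: prod_eq_iff)
  qed
  have cong_iff: "[a = b] (mod int n) \<Longrightarrow> [c = d] (mod int n) \<Longrightarrow>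
      [a = c] (mod int n) \<longleftrightarrow> [b = d] (mod int n)" for a b c d :: int
    by (simp add: cong_def)
  have "\<Phi> x \<in> {0..<int n} \<times> closed_differences n ps" if x: "x \<in> top_labellings n ps" for x
  proof -
    have "[(\<Sum>i<?m. (x (?s i) - x i) mod int n) = (\<Sum>i<?m. x (?s i) - x i)] (mod int n)"
      by (intro cong_sum) simp
    also have "(\<Sum>i<?m. x (?s i) - x i) = 0"
      by (simp only: sum_subtractf sum_cyclic_shift diff_self)
    finally have "[(\<Sum>i<?m. (x (?s i) - x i) mod int n) = 0] (mod int n)" .
    moreover have "[ps ! i * ((x (?s i) - x i) mod int n) = ps ! j * ((x (?s j) - x j) mod int n)] (mod int n)"
      if "i < ?m" "j < ?m" for i j
    proof -
      have "[ps ! i * (x (?s i) - x i) = ps ! j * (x (?s j) - x j)] (mod int n)"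
        using x that unfolding top_labellings_def by blast
      then show ?thesis by (simp add: cong_def mod_mult_right_eq)
    qed
    moreover have "x 0 \<in> {0..<int n}" using x m by (auto simp: top_labellings_def)
    ultimately show ?thesis
      using n by (auto simp: \<Phi>_def closed_differences_def)
  qed
  moreover have "\<Psi> td \<in> top_labellings n ps" if td: "td \<in> {0..<int n} \<times> closed_differences n ps" for td
  proof -
    obtain t d where [simp]: "td = (t, d)" by fastforce
    have d: "[(\<Sum>i<?m. d i) = 0] (mod int n)"
      and adj: "\<And>i j. i < ?m \<Longrightarrow> j < ?m \<Longrightarrow> [ps ! i * d i = ps ! j * d j] (mod int n)"
      using td by (auto simp: closed_differences_def)
    have "[ps ! i * (\<Psi> td (?s i) - \<Psi> td i) = ps ! j * (\<Psi> td (?s j) - \<Psi> td j)] (mod int n)"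
      if "i < ?m" "j < ?m" for i j
      using cong_iff[OF cong_scalar_left[OF diff[OF d that(1)]] cong_scalar_left[OF diff[OF d that(2)]]]
        adj[OF that] by simp
    moreover have "\<Psi> td \<in> {..<?m} \<rightarrow>\<^sub>E {0..<int n}" using n by (auto simp: \<Psi>_def)
    ultimately show ?thesis unfolding top_labellings_def by blast
  qed
  ultimately have "bij_betw \<Phi> (top_labellings n ps) ({0..<int n} \<times> closed_differences n ps)"
    using left right by (intro bij_betw_byWitness[where f' = \<Psi>]) blast+
  then show ?thesis unfolding \<Phi>_def .
qed

text \<open>
  A vanishing entry forces the common value of \<open>ps ! i * d i\<close> to be zero. Since \<open>n\<close> is prime, \<open>d\<close>
  vanishes off \<open>Z\<close>, and on \<open>Z\<close> only the sum is constrained: fixing \<open>z\<close> in \<open>Z\<close>, the values on the rest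
  of \<open>Z\<close> are free and determine \<open>d z\<close>.
\<close>

lemma card_closed_differences_singular:
  assumes n: "prime n" and Z: "Z = {i. i < length ps \<and> int n dvd ps ! i}" "Z \<noteq> {}"
  shows "card (closed_differences n ps) = n ^ (card Z - 1)"
proof -
  let ?m = "length ps"
  obtain z where z: "z \<in> Z" using Z(2) by blast
  have n0: "int n > 0" using n by (simp add: prime_gt_0_nat)
  have fin: "finite Z" using Z(1) by simp
  define ext where "ext e = (\<lambda>i\<in>{..<?m}. if i = z then (- (\<Sum>j\<in>Z - {z}. e j)) mod int n
      else if i \<in> Z then e i else 0)" for e :: "nat \<Rightarrow> int"
  have zero: "[ps ! i * d = 0] (mod int n)" if "i \<in> Z" for i d
    using that by (auto simp: Z cong_0_iff)
  have off: "d i = 0" if d: "d \<in> closed_differences n ps" and i: "i < ?m" "i \<notin> Z" for d i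
  proof -
    have "z < ?m" using z by (simp add: Z)
    then have "[ps ! i * d i = ps ! z * d z] (mod int n)"
      using d i unfolding closed_differences_def by blast
    then have "[ps ! i * d i = 0] (mod int n)" using zero[OF z] by (rule cong_trans)
    then have "int n dvd d i"
      using i n by (auto simp: cong_0_iff prime_dvd_mult_iff Z)
    moreover have "d i \<in> {0..<int n}" using d i by (auto simp: closed_differences_def)
    ultimately show ?thesis using zdvd_imp_le by fastforce
  qed
  have sum: "(\<Sum>i<?m. d i) = d z + (\<Sum>i\<in>Z - {z}. d i)" if "\<And>i. i < ?m \<Longrightarrow> i \<notin> Z \<Longrightarrow> d i = 0" for d :: "nat \<Rightarrow> int"
  proof -
    have "(\<Sum>i<?m. d i) = (\<Sum>i\<in>Z. d i)"
      using that by (intro sum.mono_neutral_right) (auto simp: Z)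
    then show ?thesis using z fin by (simp add: sum.remove)
  qed
  have "bij_betw (\<lambda>d. restrict d (Z - {z})) (closed_differences n ps) (Z - {z} \<rightarrow>\<^sub>E {0..<int n})"
  proof (rule bij_betw_byWitness[where f' = ext])
    show "\<forall>d\<in>closed_differences n ps. ext (restrict d (Z - {z})) = d"
    proof (intro ballI HOL.ext)
      fix d i assume d: "d \<in> closed_differences n ps"
      have "[d z + (\<Sum>i\<in>Z - {z}. d i) = 0] (mod int n)"
        using d sum[of d] off[OF d] by (simp add: closed_differences_def)
      then have "[d z = - (\<Sum>i\<in>Z - {z}. d i)] (mod int n)"
        by (simp add: cong_iff_dvd_diff)
      moreover have "d z \<in> {0..<int n}" using d z by (auto simp: closed_differences_def Z)
      ultimately have "(- (\<Sum>i\<in>Z - {z}. d i)) mod int n = d z" by (simp add: cong_def)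
      moreover have "(\<Sum>i\<in>Z - {z}. restrict d (Z - {z}) i) = (\<Sum>i\<in>Z - {z}. d i)"
        by (intro sum.cong) simp_all
      ultimately have "ext (restrict d (Z - {z})) z = d z"
        using z by (simp add: ext_def Z)
      moreover have "d i = undefined" if "\<not> i < ?m"
        using d that by (auto simp: closed_differences_def PiE_def extensional_def)
      ultimately show "ext (restrict d (Z - {z})) i = d i"
        using off[OF d, of i] by (cases "i = z") (auto simp: ext_def)
    qed
    show "\<forall>e\<in>Z - {z} \<rightarrow>\<^sub>E {0..<int n}. restrict (ext e) (Z - {z}) = e"
      by (auto simp: ext_def Z PiE_def extensional_def fun_eq_iff)
    show "(\<lambda>d. restrict d (Z - {z})) ` closed_differences n ps \<subseteq> Z - {z} \<rightarrow>\<^sub>E {0..<int n}"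
    proof (intro image_subsetI)
      fix d assume "d \<in> closed_differences n ps"
      then have "d i \<in> {0..<int n}" if "i \<in> Z" for i
        using that by (auto simp: closed_differences_def Z)
      then show "restrict d (Z - {z}) \<in> Z - {z} \<rightarrow>\<^sub>E {0..<int n}"
        by (simp add: restrict_PiE_iff)
    qed
    show "ext ` (Z - {z} \<rightarrow>\<^sub>E {0..<int n}) \<subseteq> closed_differences n ps"
    proof (intro image_subsetI)
      fix e assume e: "e \<in> Z - {z} \<rightarrow>\<^sub>E {0..<int n}"
      have "e i \<in> {0..<int n}" if "i \<in> Z" "i \<noteq> z" for i using PiE_mem[OF e, of i] that by blast
      then have ext_range: "ext e \<in> {..<?m} \<rightarrow>\<^sub>E {0..<int n}"
        using n0 by (auto simp: ext_def)
      have e_off: "ext e i = 0" if "i < ?m" "i \<notin> Z" for i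
        using that z by (auto simp: ext_def)
      have "(\<Sum>i<?m. ext e i) = ext e z + (\<Sum>i\<in>Z - {z}. ext e i)"
        using e_off by (rule sum)
      moreover have "(\<Sum>i\<in>Z - {z}. ext e i) = (\<Sum>i\<in>Z - {z}. e i)"
        by (intro sum.cong) (auto simp: ext_def Z)
      moreover have "ext e z = (- (\<Sum>j\<in>Z - {z}. e j)) mod int n"
        using z by (simp add: ext_def Z)
      ultimately have "[(\<Sum>i<?m. ext e i) = 0] (mod int n)"
        by (simp add: cong_def mod_add_left_eq)
      moreover have "[ps ! i * ext e i = 0] (mod int n)" if "i < ?m" for i
        using that zero[of i] e_off[of i] by (cases "i \<in> Z") auto
      ultimately show "ext e \<in> closed_differences n ps"
        using ext_range by (auto simp: closed_differences_def cong_def)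
    qed
  qed
  then have "card (closed_differences n ps) = card (Z - {z} \<rightarrow>\<^sub>E {0..<int n})"
    by (rule bij_betw_same_card)
  also have "\<dots> = n ^ (card Z - 1)"
    using z fin by (simp add: card_PiE)
  finally show ?thesis .
qed

text \<open>
  The elementary symmetric polynomial of degree \<open>length ps - 1\<close>. If the product of the entries is
  invertible, it is that product times the sum of the inverses.
\<close>

definition cofactor_sum :: "int list \<Rightarrow> int" where
  "cofactor_sum ps = (\<Sum>i<length ps. \<Prod>j\<in>{..<length ps} - {i}. ps ! j)"

text \<open>
  With \<open>A i\<close> the product of the entries other than \<open>ps ! i\<close>, every \<open>ps ! i * A i\<close> is the product of all
  entries. So the multiples of \<open>A\<close> satisfy the conditions on \<open>ps ! i * d i\<close>, and they are all the
  solutions because the entries can be cancelled. Using \<open>A\<close> as the spanning vector, instead of the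
  inverses of the entries, makes the remaining condition \<open>c * cofactor_sum ps = 0\<close>.
\<close>

lemma card_closed_differences_regular:
  assumes n: "prime n" and ps: "ps \<noteq> []" and reg: "\<And>i. i < length ps \<Longrightarrow> \<not> int n dvd ps ! i"
  shows "card (closed_differences n ps) = (if int n dvd cofactor_sum ps then n else 1)"
proof -
  let ?m = "length ps"
  define A where "A i = (\<Prod>j\<in>{..<?m} - {i}. ps ! j)" for i
  define C where "C = {c \<in> {0..<int n}. int n dvd c * cofactor_sum ps}"
  have n0: "int n > 0" and np: "prime (int n)" using n by (simp_all add: prime_gt_0_nat)
  have m: "0 < ?m" using ps by simp
  have cop: "coprime (ps ! i) (int n)" if "i < ?m" for i
    using reg[OF that] np by (simp add: coprime_commute prime_imp_coprime)
  have copA: "coprime (A i) (int n)" for i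
    unfolding A_def by (intro prod_coprime_left) (auto intro: cop)
  have PA: "ps ! i * A i = (\<Prod>j<?m. ps ! j)" if "i < ?m" for i
    unfolding A_def using that by (simp add: prod.remove)
  have sumA: "(\<Sum>i<?m. c * A i) = c * cofactor_sum ps" for c
    by (simp add: A_def cofactor_sum_def sum_distrib_left)
  have "bij_betw (\<lambda>c. \<lambda>i\<in>{..<?m}. (c * A i) mod int n) C (closed_differences n ps)"
    unfolding bij_betw_def
  proof (intro conjI inj_onI equalityI subsetI)
    fix c c' assume c: "c \<in> C" "c' \<in> C"
      and eq: "(\<lambda>i\<in>{..<?m}. (c * A i) mod int n) = (\<lambda>i\<in>{..<?m}. (c' * A i) mod int n)"
    have "[c * A 0 = c' * A 0] (mod int n)"
      using fun_cong[OF eq, of 0] m by (simp add: cong_def)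
    then have "[c = c'] (mod int n)" using copA cong_mult_rcancel by blast
    then show "c = c'" using c by (simp add: C_def cong_def)
  next
    fix d assume "d \<in> (\<lambda>c. \<lambda>i\<in>{..<?m}. (c * A i) mod int n) ` C"
    then obtain c where c: "c \<in> C" and d: "d = (\<lambda>i\<in>{..<?m}. (c * A i) mod int n)" by blast
    have "[(\<Sum>i<?m. d i) = (\<Sum>i<?m. c * A i)] (mod int n)"
      unfolding d by (intro cong_sum) simp
    then have "[(\<Sum>i<?m. d i) = 0] (mod int n)"
      using c unfolding sumA by (simp add: C_def cong_def)
    moreover have "[ps ! i * d i = c * (\<Prod>j<?m. ps ! j)] (mod int n)" if "i < ?m" for i
      using that by (simp add: d PA[OF that, symmetric] cong_def mod_mult_right_eq mult.left_commute)
    ultimately show "d \<in> closed_differences n ps"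
      using n0 unfolding closed_differences_def by (auto simp: d cong_def)
  next
    fix d assume d: "d \<in> closed_differences n ps"
    have dr: "d i \<in> {0..<int n}" if "i < ?m" for i
      using d that by (auto simp: closed_differences_def)
    \<comment> \<open>The factor \<open>c\<close> is read off at index \<open>0\<close> by inverting \<open>A 0\<close>.\<close>
    obtain u where u: "[A 0 * u = 1] (mod int n)"
      using copA cong_solve_coprime_int by blast
    define c where "c = (d 0 * u) mod int n"
    have c0: "[c * A 0 = d 0] (mod int n)"
    proof -
      have "[c * A 0 = d 0 * u * A 0] (mod int n)"
        unfolding c_def by (intro cong_scalar_right) simp
      also have "d 0 * u * A 0 = d 0 * (A 0 * u)" by simp
      also have "[d 0 * (A 0 * u) = d 0 * 1] (mod int n)"
        by (rule cong_scalar_left[OF u])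
      finally show ?thesis by simp
    qed
    have ci: "[c * A i = d i] (mod int n)" if i: "i < ?m" for i
    proof -
      have "ps ! i * (c * A i) = ps ! 0 * (c * A 0)"
        using PA[OF i] PA[OF m] by (metis mult.left_commute)
      also have "[ps ! 0 * (c * A 0) = ps ! 0 * d 0] (mod int n)"
        by (rule cong_scalar_left[OF c0])
      also have "[ps ! 0 * d 0 = ps ! i * d i] (mod int n)"
        using d i m unfolding closed_differences_def by blast
      finally show ?thesis using cop[OF i] cong_mult_lcancel by blast
    qed
    have "[c * cofactor_sum ps = (\<Sum>i<?m. d i)] (mod int n)"
      unfolding sumA[symmetric] by (intro cong_sum ci) simp
    also have "[(\<Sum>i<?m. d i) = 0] (mod int n)"
      using d by (simp add: closed_differences_def)
    finally have "c \<in> C" using n0 by (simp add: C_def c_def cong_0_iff)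
    moreover have "d = (\<lambda>i\<in>{..<?m}. (c * A i) mod int n)"
    proof
      fix i
      show "d i = (\<lambda>i\<in>{..<?m}. (c * A i) mod int n) i"
        using ci[of i] dr[of i] d
        by (cases "i < ?m") (auto simp: cong_def closed_differences_def PiE_def extensional_def)
    qed
    ultimately show "d \<in> (\<lambda>c. \<lambda>i\<in>{..<?m}. (c * A i) mod int n) ` C" by blast
  qed
  then have "card (closed_differences n ps) = card C"
    by (metis bij_betw_same_card)
  moreover have "C = (if int n dvd cofactor_sum ps then {0..<int n} else {0})"
    using n0 np by (auto simp: C_def prime_dvd_mult_iff dest: zdvd_imp_le)
  ultimately show ?thesis by simp
qed

section \<open>Coloring numbers of pretzel links\<close>

text \<open>
  The free color of the first top edge contributes one factor \<open>n\<close>, the differences the rest.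
\<close>

theorem card_Hom_pretzel:
  assumes n: "prime n" and ps: "ps \<noteq> []" "\<forall>p\<in>set ps. p \<noteq> 0"
    and out: "orientation (pretzel ps) out"
    and Z: "Z = {i. i < length ps \<and> int n dvd ps ! i}"
  shows "card (Hom (fundamental_quandle (pretzel ps) out) (dihedral_quandle n)) =
    (if Z = {} then if int n dvd cofactor_sum ps then n ^ 2 else n else n ^ card Z)"
proof -
  let ?D = "pretzel ps"
  have n0: "n > 0" using n by (rule prime_gt_0_nat)
  have D: "link_diagram ?D" using ps by (rule link_diagram_pretzel)
  have "card (Hom (fundamental_quandle ?D out) (dihedral_quandle n)) = card (fox_colorings n ?D)"
    unfolding card_Hom_fundamental_quandle[OF D dihedral_quandle_is_quandle]
      colorings_dihedral_quandle[OF D out] ..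
  also have "\<dots> = card (top_labellings n ps)"
    by (rule bij_betw_same_card[OF bij_betw_fox_colorings_pretzel[OF ps(2) n0]])
  also have "\<dots> = card ({0..<int n} \<times> closed_differences n ps)"
    by (rule bij_betw_same_card[OF bij_betw_top_labellings[OF n0 ps(1)]])
  also have "\<dots> = n * card (closed_differences n ps)"
    by (simp add: card_cartesian_product)
  also have "\<dots> = (if Z = {} then if int n dvd cofactor_sum ps then n ^ 2 else n else n ^ card Z)"
  proof (cases "Z = {}")
    case True
    then show ?thesis
      using card_closed_differences_regular[OF n ps(1)] unfolding Z
      by (auto simp: power2_eq_square)
  next
    case False
    moreover have "finite Z" using Z by simp
    ultimately have "card Z = Suc (card Z - 1)" by (simp add: card_gt_0_iff)
    then have "n * n ^ (card Z - 1) = n ^ card Z" by (metis power_Suc)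
    then show ?thesis
      using card_closed_differences_singular[OF n Z False] False by simp
  qed
  finally show ?thesis .
qed

theorem theorem23:
  fixes n :: nat and p :: "nat \<Rightarrow> int" and out :: "nat \<times> nat \<Rightarrow> corner \<Rightarrow> bool"
  assumes "prime n"
    and "\<forall>i\<in>{1..4}. p i > 0"
    and "orientation (pretzel [p 1, p 2, p 3, p 4]) out"
  shows "let h = p 1 * p 2 * p 3 + p 1 * p 2 * p 4 + p 1 * p 3 * p 4 + p 2 * p 3 * p 4;
             N = card (Hom (fundamental_quandle (pretzel [p 1, p 2, p 3, p 4]) out)
                           (dihedral_quandle n))
         in (\<not> [h = 0] (mod int n) \<longrightarrow> N = n) \<and>
            ([h = 0] (mod int n) \<and>
               (\<exists>i\<in>{1..4}. \<exists>j\<in>{1..4}. i \<noteq> j \<and> \<not> [p i * p j = 0] (mod int n))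
             \<longrightarrow> N = n ^ 2) \<and>
            ((\<exists>!i. i \<in> {1..4} \<and> coprime (p i) (int n)) \<longrightarrow> N = n ^ 3) \<and>
            ((\<forall>i\<in>{1..4}. [p i = 0] (mod int n)) \<longrightarrow> N = n ^ 4)"
proof -
  let ?ps = "[p 1, p 2, p 3, p 4]"
  let ?h = "p 1 * p 2 * p 3 + p 1 * p 2 * p 4 + p 1 * p 3 * p 4 + p 2 * p 3 * p 4"
  let ?N = "card (Hom (fundamental_quandle (pretzel ?ps) out) (dihedral_quandle n))"
  have four: "{1..4} = {1, 2, 3, 4::nat}" and lt4: "{..<4} = {0, 1, 2, 3::nat}"
    by auto
  define Z where "Z = {i. i < length ?ps \<and> int n dvd ?ps ! i}"
  have Z: "Z = {i. i = 0 \<and> int n dvd p 1} \<union> {i. i = 1 \<and> int n dvd p 2} \<union>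
      {i. i = 2 \<and> int n dvd p 3} \<union> {i. i = 3 \<and> int n dvd p 4}"
  proof (intro set_eqI)
    fix i :: nat
    consider "i = 0" | "i = 1" | "i = 2" | "i = 3" | "i \<ge> 4" by linarith
    then show "i \<in> Z \<longleftrightarrow> i \<in> {i. i = 0 \<and> int n dvd p 1} \<union> {i. i = 1 \<and> int n dvd p 2} \<union>
      {i. i = 2 \<and> int n dvd p 3} \<union> {i. i = 3 \<and> int n dvd p 4}"
      by cases (simp_all add: Z_def)
  qed
  have cof: "cofactor_sum ?ps = ?h"
  proof -
    have "length ?ps = 4" by simp
    then have "cofactor_sum ?ps = (\<Sum>i\<in>{0, 1, 2, 3}. \<Prod>j\<in>{0, 1, 2, 3} - {i}. ?ps ! j)"
      unfolding cofactor_sum_def by (simp only: lt4)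
    then show ?thesis by (simp add: insert_Diff_if)
  qed
  have "prime (int n)" using assms(1) by simp
  then have dvd_mult: "int n dvd a * b \<longleftrightarrow> int n dvd a \<or> int n dvd b"
    and cop: "coprime a (int n) \<longleftrightarrow> \<not> int n dvd a" for a b
    by (rule prime_dvd_mult_iff,
        metis coprime_absorb_left coprime_commute not_prime_unit prime_imp_coprime)
  have nz: "\<forall>q\<in>set ?ps. q \<noteq> 0"
    using assms(2)[unfolded four] by fastforce
  have N: "?N = (if Z = {} then if int n dvd ?h then n ^ 2 else n else n ^ card Z)"
    using card_Hom_pretzel[OF assms(1) list.distinct(2) nz assms(3) Z_def] unfolding cof .
  note powers = power2_eq_square power3_eq_cube power4_eq_xxxx
  show ?thesis
    unfolding Let_def cong_0_iff four cop
  proof (intro conjI impI)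
    \<comment> \<open>Two vanishing entries would make \<open>h\<close> vanish, so at most one does, and \<open>card Z\<close> is \<open>0\<close> or \<open>1\<close>.\<close>
    assume "\<not> int n dvd ?h"
    then show "?N = n"
      unfolding N
      by (cases "int n dvd p 1"; cases "int n dvd p 2"; cases "int n dvd p 3"; cases "int n dvd p 4";
          simp add: Z dvd_mult)
  next
    \<comment> \<open>With exactly one vanishing entry, three of the four terms of \<open>h\<close> would vanish but not the
       fourth; with three or more, every \<open>p i * p j\<close> would vanish.\<close>
    assume "int n dvd ?h \<and>
      (\<exists>i\<in>{1, 2, 3, 4}. \<exists>j\<in>{1, 2, 3, 4}. i \<noteq> j \<and> \<not> int n dvd p i * p j)"
    then show "?N = n ^ 2"
      unfolding N
      by (cases "int n dvd p 1"; cases "int n dvd p 2"; cases "int n dvd p 3"; cases "int n dvd p 4";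
          simp add: Z dvd_mult powers dvd_add_left_iff dvd_add_right_iff)
  next
    assume "\<exists>!i. i \<in> {1, 2, 3, 4} \<and> \<not> int n dvd p i"
    then obtain k where k: "k \<in> {1, 2, 3, 4}" "\<not> int n dvd p k"
      and others: "\<And>i. i \<in> {1, 2, 3, 4} \<Longrightarrow> i \<noteq> k \<Longrightarrow> int n dvd p i"
      by blast
    from k(1) consider "k = 1" | "k = 2" | "k = 3" | "k = 4" by blast
    then show "?N = n ^ 3"
      unfolding N using k(2) others[of 1] others[of 2] others[of 3] others[of 4]
      by cases (simp_all add: Z powers)
  next
    assume "\<forall>i\<in>{1, 2, 3, 4}. int n dvd p i"
    then show "?N = n ^ 4"
      unfolding N by (simp add: Z powers)
  qed
qed

end
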